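(* Let $M$ be a screen generic lightlike submanifold of a locally bronze semi-Riemannian manifold $(\bar M,\bar g,\bar J)$ with an $(l,m)$-type connection $\bar\Omega$. Then the distribution $B'$ is parallel if and only if both of the following hold for all $Y,Z\in\Gamma(B')$, $X\in\Gamma(B_o)$ and $N\in\Gamma(\mathrm{ltr}(TM))$: (i) $\bar g(\bar h^{*}(Y,fZ),\bar JN)+3\bar g(\bar A_{wZ}Y,N)=3\bar g(\bar h^{*}(Y,fZ),N)+\bar g(\bar A_{wZ}Y,\bar JN)$; (ii) $\bar g(\Omega^{*}_YfZ,\bar JX)+3\bar g(\bar A_{wZ}Y,X)=\bar g(\bar A_{wZ}Y,\bar JX)+3\bar g(\Omega^{*}_YfZ,X)$.
   Context: Bronze manifold: a semi-Riemannian manifold $(\bar M,\bar g)$ (of constant index $q$, $1\le q\le \dim\bar M-1$) with a $(1,1)$-tensor field $\bar J$ satisfying $\bar J^2=3\bar J+I$ and $\bar g(\bar JX,Y)=\bar g(X,\bar JY)$; it is locally bronze if $\bar\nabla\bar J=0$ for the Levi-Civita connection $\bar\nabla$. Lightlike submanifold: $M\subset\bar M$ such that $\mathrm{Rad}\,TM=TM\cap TM^\perp$ is a distribution of constant rank $r>0$; $g$ is the induced metric. One fixes $S(TM)$, $S(TM^\perp)$ with $TM=\mathrm{Rad}\,TM\perp S(TM)$, $TM^\perp=\mathrm{Rad}\,TM\perp S(TM^\perp)$, and a lightlike transversal bundle $\mathrm{ltr}(TM)$ (locally spanned by $N_1,\dots,N_r$ in $S(TM^\perp)^\perp$, orthogonal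 to $S(TM)$, with $\bar g(N_i,\xi_j)=\delta_{ij}$, $\bar g(N_i,N_j)=0$ for a local basis $\xi_1,\dots,\xi_r$ of $\mathrm{Rad}\,TM$). Then $T\bar M|_M=TM\oplus \mathrm{tr}(TM)$ with $\mathrm{tr}(TM)=\mathrm{ltr}(TM)\perp S(TM^\perp)$. For $X\in\Gamma(TM)$ write $\bar JX=fX+wX$ with $fX$ tangential and $wX\in\Gamma(\mathrm{tr}(TM))$. Screen generic: $M$ is screen generic if $\bar J(\mathrm{Rad}\,TM)=\mathrm{Rad}\,TM$ and $B_o=\bar J(S(TM))\cap S(TM)$ is a non-degenerate distribution; $B'$ denotes the complementary (orthogonal) non-degenerate distribution in $S(TM)$, so $S(TM)=B_o\oplus B'$, with (when $B'\neq\{0\}$) $\bar J(B')\not\subseteq S(TM)$ and $\bar J(B')\not\subseteq S(TM^\perp)$, and $fY\in\Gamma(B')$, $wY\in\Gamma(S(TM^\perp))$ for $Y\in\Gamma(B')$. $(l,m)$-type connection: let $l,m$ be smooth functions on $\bar M$, $(l,m)\ne(0,0)$, $\eta$ a smooth unit spacelike vector field on $\bar M$, $\theta(X)=\bar g(X,\eta)$. Then $\bar\Omega_XY=\bar\nabla_XY+\theta(Y)\{lX+m\bar JX\}$. Induced objects: for $X,Y\in\Gamma(TM)$, $\bar\Omega_XY=\Omega_XY+\bar h^{l}(X,Y)+\bar h^{s}(X,Y)$ with components in $TM$, $\mathrm{ltr}(TM)$, $S(TM^\perp)$ respectively; for $W\in\Gamma(S(TM^\perp))$, $\bar\Omega_XW=-\bar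 A_WX+\bar\Omega^s_XW+\bar D^l(X,W)$ with components in $TM$, $S(TM^\perp)$, $\mathrm{ltr}(TM)$ respectively; for $Y\in\Gamma(S(TM))$, $\Omega_XY=\Omega^{*}_XY+\bar h^{*}(X,Y)$ with $\Omega^*_XY\in\Gamma(S(TM))$, $\bar h^*(X,Y)\in\Gamma(\mathrm{Rad}\,TM)$. $B'$ is parallel if $\Omega_YZ\in\Gamma(B')$ for all $Y,Z\in\Gamma(B')$, i.e. $\bar g(\Omega_YZ,X)=0$ and $\bar g(\Omega_YZ,N)=0$ for all $X\in\Gamma(B_o)$, $N\in\Gamma(\mathrm{ltr}(TM))$.
   Formalization: The formal theorem additionally assumes $\bar J(\mathrm{ltr}(TM))=\mathrm{ltr}(TM)$; without it the equivalence fails, since for suitable choices of the screen and transversal bundles $B'$ is parallel while (i) is false. *)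

theory Defs
  imports "HOL-Analysis.Analysis" "HOL-Library.Set_Algebras"
begin

section \<open>Smooth maps between open subsets of Euclidean spaces\<close>

text \<open>These notions are only used on open sets \<open>S\<close>.\<close>

primrec Ck_on :: "nat \<Rightarrow> 'a::euclidean_space set \<Rightarrow> ('a \<Rightarrow> 'b::real_normed_vector) \<Rightarrow> bool" where
  "Ck_on 0 S f \<longleftrightarrow> continuous_on S f"
| "Ck_on (Suc k) S f \<longleftrightarrow>
     (\<forall>x\<in>S. f differentiable (at x)) \<and> (\<forall>v. Ck_on k S (\<lambda>x. frechet_derivative f (at x) v))"

definition smooth_on :: "'a::euclidean_space set \<Rightarrow> ('a \<Rightarrow> 'b::real_normed_vector) \<Rightarrow> bool" where
  "smooth_on S f \<longleftrightarrow> (\<forall>k. Ck_on k S f)"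


section \<open>Manifolds, tangent vectors and fields along a map\<close>

text \<open>
  A manifold is a Hausdorff, second countable type \<open>'m\<close> with an atlas modelled on a Euclidean space
  \<open>'e\<close>.  The atlas is indexed by points: \<open>A p\<close> is a chart (domain and coordinate map) around \<open>p\<close>.
  A tangent vector at \<open>p\<close> is given by its components in the chart \<open>A p\<close>, so the tangent space at
  each point is a copy of \<open>'e\<close>, and vectors at different points are compared only through
  \<open>coord\<close> below.
\<close>

type_synonym ('m, 'e) atlas = "'m \<Rightarrow> 'm set \<times> ('m \<Rightarrow> 'e)"

abbreviation cdom :: "('m, 'e) atlas \<Rightarrow> 'm \<Rightarrow> 'm set" where
  "cdom A p \<equiv> fst (A p)"

abbreviation cmap :: "('m, 'e) atlas \<Rightarrow> 'm \<Rightarrow> 'm \<Rightarrow> 'e" where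
  "cmap A p \<equiv> snd (A p)"

abbreviation cinv :: "('m, 'e) atlas \<Rightarrow> 'm \<Rightarrow> 'e \<Rightarrow> 'm" where
  "cinv A p \<equiv> inv_into (cdom A p) (cmap A p)"

definition smooth_manifold ::
  "('m::{t2_space, second_countable_topology}, 'e::euclidean_space) atlas \<Rightarrow> bool" where
  "smooth_manifold A \<longleftrightarrow>
     (\<forall>p. p \<in> cdom A p \<and> open (cdom A p) \<and> open (cmap A p ` cdom A p) \<and>
          homeomorphism (cdom A p) (cmap A p ` cdom A p) (cmap A p) (cinv A p)) \<and>
     (\<forall>p q. smooth_on (cmap A p ` (cdom A p \<inter> cdom A q)) (cmap A q \<circ> cinv A p))"

definition smooth_fun :: "('m, 'e::euclidean_space) atlas \<Rightarrow> ('m \<Rightarrow> real) \<Rightarrow> bool" where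
  "smooth_fun A h \<longleftrightarrow> (\<forall>p. smooth_on (cmap A p ` cdom A p) (h \<circ> cinv A p))"

definition smooth_map ::
  "('s::topological_space, 'd::euclidean_space) atlas \<Rightarrow>
   ('m::topological_space, 'e::euclidean_space) atlas \<Rightarrow> ('s \<Rightarrow> 'm) \<Rightarrow> bool" where
  "smooth_map B A F \<longleftrightarrow> continuous_on UNIV F \<and>
     (\<forall>p q. smooth_on (cmap B p ` (cdom B p \<inter> F -` cdom A q)) (cmap A q \<circ> F \<circ> cinv B p))"

definition differential ::
  "('s, 'd::euclidean_space) atlas \<Rightarrow> ('m, 'e::euclidean_space) atlas \<Rightarrow> ('s \<Rightarrow> 'm) \<Rightarrow> 's \<Rightarrow> 'd \<Rightarrow> 'e"
  where
  "differential B A F p = frechet_derivative (cmap A (F p) \<circ> F \<circ> cinv B p) (at (cmap B p p))"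

definition injective_immersion ::
  "('s::topological_space, 'd::euclidean_space) atlas \<Rightarrow>
   ('m::topological_space, 'e::euclidean_space) atlas \<Rightarrow> ('s \<Rightarrow> 'm) \<Rightarrow> bool" where
  "injective_immersion B A F \<longleftrightarrow>
     smooth_map B A F \<and> inj F \<and> (\<forall>p. inj (differential B A F p))"

text \<open>Components, in the chart \<open>A q\<close>, of a tangent vector \<open>v\<close> at the point \<open>x\<close> of its domain.\<close>

definition coord :: "('m, 'e::euclidean_space) atlas \<Rightarrow> 'm \<Rightarrow> 'm \<Rightarrow> 'e \<Rightarrow> 'e" where
  "coord A q x v = frechet_derivative (cmap A q \<circ> cinv A x) (at (cmap A x x)) v"

text \<open>
  \<open>Y\<close> is a field along \<open>F : N \<rightarrow> M\<close>, i.e. \<open>Y p\<close> is tangent to \<open>M\<close> at \<open>F p\<close>; it is required to be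
  smooth on the open set \<open>V\<close>.  Vector fields on \<open>M\<close> are the case \<open>F = id\<close>.
\<close>

definition smooth_field_on ::
  "('s, 'd::euclidean_space) atlas \<Rightarrow> ('m, 'e::euclidean_space) atlas \<Rightarrow> ('s \<Rightarrow> 'm) \<Rightarrow> 's set \<Rightarrow>
   ('s \<Rightarrow> 'e) \<Rightarrow> bool" where
  "smooth_field_on B A F V Y \<longleftrightarrow>
     (\<forall>p q. smooth_on (cmap B p ` (cdom B p \<inter> F -` cdom A q \<inter> V))
              (\<lambda>u. coord A q (F (cinv B p u)) (Y (cinv B p u))))"

definition vector_fields :: "('m, 'e::euclidean_space) atlas \<Rightarrow> ('m \<Rightarrow> 'e) set" where
  "vector_fields A = {X. smooth_field_on A A id UNIV X}"

text \<open>Derivative \<open>X h\<close> of a function along a vector field.\<close>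

definition vderiv :: "('m, 'e::euclidean_space) atlas \<Rightarrow> ('m \<Rightarrow> 'e) \<Rightarrow> ('m \<Rightarrow> real) \<Rightarrow> 'm \<Rightarrow> real" where
  "vderiv A X h p = frechet_derivative (h \<circ> cinv A p) (at (cmap A p p)) (X p)"


section \<open>Connections\<close>

text \<open>
  An affine connection is given by its coefficients: \<open>C p x y\<close> is the bilinear Christoffel term at
  \<open>p\<close> in the chart \<open>A p\<close>, so that there \<open>\<nabla>\<^sub>X Y = dY(X) + C(X, Y)\<close>.  The same formula gives the
  covariant derivative of a field \<open>Y\<close> along \<open>F\<close>, in the direction of a field \<open>X\<close> along \<open>F\<close> whose
  values \<open>X p\<close> are in the image of the (injective) differential of \<open>F\<close>; this is the restriction of
  the ambient connection to fields along \<open>F\<close>.  The connection on the manifold itself is the case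
  \<open>F = id\<close>.
\<close>

definition nabla ::
  "('m, 'e::euclidean_space) atlas \<Rightarrow> ('m \<Rightarrow> 'e \<Rightarrow> 'e \<Rightarrow> 'e) \<Rightarrow> ('s, 'd::euclidean_space) atlas \<Rightarrow>
   ('s \<Rightarrow> 'm) \<Rightarrow> ('s \<Rightarrow> 'e) \<Rightarrow> ('s \<Rightarrow> 'e) \<Rightarrow> 's \<Rightarrow> 'e" where
  "nabla A C B F X Y p =
     frechet_derivative (\<lambda>u. coord A (F p) (F (cinv B p u)) (Y (cinv B p u))) (at (cmap B p p))
       (inv (differential B A F p) (X p))
     + C (F p) (X p) (Y p)"

definition affine_connection ::
  "('m, 'e::euclidean_space) atlas \<Rightarrow> ('m \<Rightarrow> 'e \<Rightarrow> 'e \<Rightarrow> 'e) \<Rightarrow> bool" where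
  "affine_connection A C \<longleftrightarrow> (\<forall>p. bilinear (C p)) \<and>
     (\<forall>X\<in>vector_fields A. \<forall>Y\<in>vector_fields A. nabla A C A id X Y \<in> vector_fields A)"

definition levi_civita ::
  "('m, 'e::euclidean_space) atlas \<Rightarrow> ('m \<Rightarrow> 'e \<Rightarrow> 'e \<Rightarrow> real) \<Rightarrow> ('m \<Rightarrow> 'e \<Rightarrow> 'e \<Rightarrow> 'e) \<Rightarrow> bool" where
  "levi_civita A g C \<longleftrightarrow> affine_connection A C \<and>
     \<comment> \<open>torsion-free, i.e. \<open>\<nabla>\<^sub>X Y - \<nabla>\<^sub>Y X = [X, Y]\<close> as derivations of smooth functions\<close>
     (\<forall>X\<in>vector_fields A. \<forall>Y\<in>vector_fields A. \<forall>h. smooth_fun A h \<longrightarrow> (\<forall>p.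
        vderiv A (nabla A C A id X Y) h p - vderiv A (nabla A C A id Y X) h p
        = vderiv A X (vderiv A Y h) p - vderiv A Y (vderiv A X h) p)) \<and>
     (\<forall>X\<in>vector_fields A. \<forall>Y\<in>vector_fields A. \<forall>Z\<in>vector_fields A. \<forall>p.
        vderiv A X (\<lambda>x. g x (Y x) (Z x)) p
        = g p (nabla A C A id X Y p) (Z p) + g p (Y p) (nabla A C A id X Z p))"


section \<open>Locally bronze semi-Riemannian manifolds with an \<open>(l,m)\<close>-type connection\<close>

definition form_index :: "('e::euclidean_space \<Rightarrow> 'e \<Rightarrow> real) \<Rightarrow> nat" where
  "form_index b = Max (dim ` {W. subspace W \<and> (\<forall>w\<in>W. w \<noteq> 0 \<longrightarrow> b w w < 0)})"

definition semi_riemannian ::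
  "('m, 'e::euclidean_space) atlas \<Rightarrow> ('m \<Rightarrow> 'e \<Rightarrow> 'e \<Rightarrow> real) \<Rightarrow> nat \<Rightarrow> bool" where
  "semi_riemannian A g q \<longleftrightarrow>
     (\<forall>p. bilinear (g p) \<and> (\<forall>u v. g p u v = g p v u) \<and>
          (\<forall>u. (\<forall>v. g p u v = 0) \<longrightarrow> u = 0) \<and> form_index (g p) = q) \<and>
     (\<forall>X\<in>vector_fields A. \<forall>Y\<in>vector_fields A. smooth_fun A (\<lambda>p. g p (X p) (Y p)))"

text \<open>\<open>conn\<close> holds the coefficients of the Levi-Civita connection.\<close>

record ('m, 'e) ambient =
  atl :: "('m, 'e) atlas"
  met :: "'m \<Rightarrow> 'e \<Rightarrow> 'e \<Rightarrow> real"
  brz :: "'m \<Rightarrow> 'e \<Rightarrow> 'e"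
  conn :: "'m \<Rightarrow> 'e \<Rightarrow> 'e \<Rightarrow> 'e"
  lfn :: "'m \<Rightarrow> real"
  mfn :: "'m \<Rightarrow> real"
  eta :: "'m \<Rightarrow> 'e"

definition bronze_manifold ::
  "('m::{t2_space, second_countable_topology}, 'e::euclidean_space) ambient \<Rightarrow> bool" where
  "bronze_manifold A \<longleftrightarrow> smooth_manifold (atl A) \<and>
     (\<exists>q. 1 \<le> q \<and> q \<le> DIM('e) - 1 \<and> semi_riemannian (atl A) (met A) q) \<and>
     (\<forall>p. linear (brz A p) \<and> (\<forall>v. brz A p (brz A p v) = 3 *\<^sub>R brz A p v + v) \<and>
          (\<forall>u v. met A p (brz A p u) v = met A p u (brz A p v))) \<and>
     (\<forall>X\<in>vector_fields (atl A). (\<lambda>p. brz A p (X p)) \<in> vector_fields (atl A))"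

definition locally_bronze_manifold ::
  "('m::{t2_space, second_countable_topology}, 'e::euclidean_space) ambient \<Rightarrow> bool" where
  "locally_bronze_manifold A \<longleftrightarrow> bronze_manifold A \<and> levi_civita (atl A) (met A) (conn A) \<and>
     (\<forall>X\<in>vector_fields (atl A). \<forall>Y\<in>vector_fields (atl A). \<forall>p.
        nabla (atl A) (conn A) (atl A) id X (\<lambda>x. brz A x (Y x)) p
        = brz A p (nabla (atl A) (conn A) (atl A) id X Y p))"

definition lm_data :: "('m, 'e::euclidean_space) ambient \<Rightarrow> bool" where
  "lm_data A \<longleftrightarrow> smooth_fun (atl A) (lfn A) \<and> smooth_fun (atl A) (mfn A) \<and>
     (lfn A, mfn A) \<noteq> (\<lambda>_. 0, \<lambda>_. 0) \<and>
     eta A \<in> vector_fields (atl A) \<and> (\<forall>p. met A p (eta A p) (eta A p) = 1)"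


section \<open>Lightlike submanifolds\<close>

text \<open>
  The submanifold is the type \<open>'s\<close> with atlas \<open>satl\<close>, included by the injective immersion \<open>imm\<close>.
  All bundles over it are subbundles of the restricted ambient tangent bundle, i.e. families of
  subspaces of \<open>'e\<close>: \<open>scr\<close>, \<open>scrt\<close>, \<open>ltr\<close> are \<open>S(TM)\<close>, \<open>S(TM\<^sup>\<bottom>)\<close>, \<open>ltr(TM)\<close>.
\<close>

record ('s, 'd, 'm, 'e) submfd =
  satl :: "('s, 'd) atlas"
  imm :: "'s \<Rightarrow> 'm"
  scr :: "'s \<Rightarrow> 'e set"
  scrt :: "'s \<Rightarrow> 'e set"
  ltr :: "'s \<Rightarrow> 'e set"

definition ip :: "('m, 'e) ambient \<Rightarrow> ('s, 'd, 'm, 'e) submfd \<Rightarrow> 's \<Rightarrow> 'e \<Rightarrow> 'e \<Rightarrow> real" where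
  "ip A M p u v = met A (imm M p) u v"

definition J :: "('m, 'e) ambient \<Rightarrow> ('s, 'd, 'm, 'e) submfd \<Rightarrow> 's \<Rightarrow> 'e \<Rightarrow> 'e" where
  "J A M p v = brz A (imm M p) v"

definition smooth_along ::
  "('m, 'e::euclidean_space) ambient \<Rightarrow> ('s, 'd::euclidean_space, 'm, 'e) submfd \<Rightarrow> 's set \<Rightarrow>
   ('s \<Rightarrow> 'e) \<Rightarrow> bool" where
  "smooth_along A M V Y \<longleftrightarrow> smooth_field_on (satl M) (atl A) (imm M) V Y"

text \<open>Smooth subbundle (distribution) of constant rank \<open>k\<close>, by local frames.\<close>

definition subbundle ::
  "('m, 'e::euclidean_space) ambient \<Rightarrow> ('s::topological_space, 'd::euclidean_space, 'm, 'e) submfd \<Rightarrow>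
   nat \<Rightarrow> ('s \<Rightarrow> 'e set) \<Rightarrow> bool" where
  "subbundle A M k E \<longleftrightarrow>
     (\<forall>p. \<exists>V. open V \<and> p \<in> V \<and> (\<exists>e :: nat \<Rightarrow> 's \<Rightarrow> 'e.
        (\<forall>i<k. smooth_along A M V (e i)) \<and>
        (\<forall>x\<in>V. span ((\<lambda>i. e i x) ` {..<k}) = E x \<and> dim (E x) = k)))"

definition sections ::
  "('m, 'e::euclidean_space) ambient \<Rightarrow> ('s, 'd::euclidean_space, 'm, 'e) submfd \<Rightarrow>
   ('s \<Rightarrow> 'e set) \<Rightarrow> ('s \<Rightarrow> 'e) set" where
  "sections A M E = {Y. smooth_along A M UNIV Y \<and> (\<forall>p. Y p \<in> E p)}"

definition TM ::
  "('m, 'e::euclidean_space) ambient \<Rightarrow> ('s, 'd::euclidean_space, 'm, 'e) submfd \<Rightarrow> 's \<Rightarrow> 'e set" where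
  "TM A M p = range (differential (satl M) (atl A) (imm M) p)"

definition TMperp ::
  "('m, 'e::euclidean_space) ambient \<Rightarrow> ('s, 'd::euclidean_space, 'm, 'e) submfd \<Rightarrow> 's \<Rightarrow> 'e set" where
  "TMperp A M p = {v. \<forall>u\<in>TM A M p. ip A M p v u = 0}"

definition Rad ::
  "('m, 'e::euclidean_space) ambient \<Rightarrow> ('s, 'd::euclidean_space, 'm, 'e) submfd \<Rightarrow> 's \<Rightarrow> 'e set" where
  "Rad A M p = TM A M p \<inter> TMperp A M p"

text \<open>
  \<open>S(TM)\<close> and \<open>S(TM\<^sup>\<bottom>)\<close> are complements of the radical; orthogonality to it is automatic.
\<close>

definition lightlike_submanifold ::
  "('m::{t2_space, second_countable_topology}, 'e::euclidean_space) ambient \<Rightarrow>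
   ('s::{t2_space, second_countable_topology}, 'd::euclidean_space, 'm, 'e) submfd \<Rightarrow> bool" where
  "lightlike_submanifold A M \<longleftrightarrow>
     smooth_manifold (satl M) \<and> injective_immersion (satl M) (atl A) (imm M) \<and>
     (\<exists>k. subbundle A M k (scr M)) \<and>
     (\<forall>p. Rad A M p \<inter> scr M p = {0} \<and> Rad A M p + scr M p = TM A M p) \<and>
     (\<exists>k. subbundle A M k (scrt M)) \<and>
     (\<forall>p. Rad A M p \<inter> scrt M p = {0} \<and> Rad A M p + scrt M p = TMperp A M p) \<and>
     (\<exists>r>0. subbundle A M r (Rad A M) \<and> subbundle A M r (ltr M) \<and>
        (\<forall>p. \<exists>V. open V \<and> p \<in> V \<and> (\<exists>(\<xi> :: nat \<Rightarrow> 's \<Rightarrow> 'e) (N :: nat \<Rightarrow> 's \<Rightarrow> 'e).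
           (\<forall>i<r. smooth_along A M V (\<xi> i) \<and> smooth_along A M V (N i)) \<and>
           (\<forall>x\<in>V. span ((\<lambda>i. \<xi> i x) ` {..<r}) = Rad A M x \<and>
                  span ((\<lambda>i. N i x) ` {..<r}) = ltr M x \<and>
                  (\<forall>i<r. (\<forall>v\<in>scr M x. ip A M x (N i x) v = 0) \<and>
                         (\<forall>v\<in>scrt M x. ip A M x (N i x) v = 0) \<and>
                         (\<forall>j<r. ip A M x (N i x) (\<xi> j x) = (if i = j then 1 else 0) \<and>
                                ip A M x (N i x) (N j x) = 0))))))"


section \<open>Induced objects\<close>

text \<open>Component in \<open>E\<close> of \<open>v\<close> with respect to the direct sum of \<open>E\<close> and \<open>E'\<close>.\<close>

definition part :: "'e::ab_group_add set \<Rightarrow> 'e set \<Rightarrow> 'e \<Rightarrow> 'e" where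
  "part E E' v = (THE a. a \<in> E \<and> v - a \<in> E')"

definition tr :: "('s, 'd, 'm, 'e::euclidean_space) submfd \<Rightarrow> 's \<Rightarrow> 'e set" where
  "tr M p = ltr M p + scrt M p"

definition fJ ::
  "('m, 'e::euclidean_space) ambient \<Rightarrow> ('s, 'd::euclidean_space, 'm, 'e) submfd \<Rightarrow>
   ('s \<Rightarrow> 'e) \<Rightarrow> 's \<Rightarrow> 'e" where
  "fJ A M X p = part (TM A M p) (tr M p) (J A M p (X p))"

definition wJ ::
  "('m, 'e::euclidean_space) ambient \<Rightarrow> ('s, 'd::euclidean_space, 'm, 'e) submfd \<Rightarrow>
   ('s \<Rightarrow> 'e) \<Rightarrow> 's \<Rightarrow> 'e" where
  "wJ A M X p = part (tr M p) (TM A M p) (J A M p (X p))"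

text \<open>The \<open>(l,m)\<close>-type connection, for \<open>X\<close> tangent to the submanifold and \<open>Y\<close> any field along it.\<close>

definition Omega_bar ::
  "('m, 'e::euclidean_space) ambient \<Rightarrow> ('s, 'd::euclidean_space, 'm, 'e) submfd \<Rightarrow>
   ('s \<Rightarrow> 'e) \<Rightarrow> ('s \<Rightarrow> 'e) \<Rightarrow> 's \<Rightarrow> 'e" where
  "Omega_bar A M X Y p =
     nabla (atl A) (conn A) (satl M) (imm M) X Y p
     + ip A M p (Y p) (eta A (imm M p)) *\<^sub>R
         (lfn A (imm M p) *\<^sub>R X p + mfn A (imm M p) *\<^sub>R J A M p (X p))"

definition Omega ::
  "('m, 'e::euclidean_space) ambient \<Rightarrow> ('s, 'd::euclidean_space, 'm, 'e) submfd \<Rightarrow>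
   ('s \<Rightarrow> 'e) \<Rightarrow> ('s \<Rightarrow> 'e) \<Rightarrow> 's \<Rightarrow> 'e" where
  "Omega A M X Y p = part (TM A M p) (tr M p) (Omega_bar A M X Y p)"

definition A_bar ::
  "('m, 'e::euclidean_space) ambient \<Rightarrow> ('s, 'd::euclidean_space, 'm, 'e) submfd \<Rightarrow>
   ('s \<Rightarrow> 'e) \<Rightarrow> ('s \<Rightarrow> 'e) \<Rightarrow> 's \<Rightarrow> 'e" where
  "A_bar A M W X p = - part (TM A M p) (tr M p) (Omega_bar A M X W p)"

definition Omega_star ::
  "('m, 'e::euclidean_space) ambient \<Rightarrow> ('s, 'd::euclidean_space, 'm, 'e) submfd \<Rightarrow>
   ('s \<Rightarrow> 'e) \<Rightarrow> ('s \<Rightarrow> 'e) \<Rightarrow> 's \<Rightarrow> 'e" where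
  "Omega_star A M X Y p = part (scr M p) (Rad A M p) (Omega A M X Y p)"

definition h_star ::
  "('m, 'e::euclidean_space) ambient \<Rightarrow> ('s, 'd::euclidean_space, 'm, 'e) submfd \<Rightarrow>
   ('s \<Rightarrow> 'e) \<Rightarrow> ('s \<Rightarrow> 'e) \<Rightarrow> 's \<Rightarrow> 'e" where
  "h_star A M X Y p = part (Rad A M p) (scr M p) (Omega A M X Y p)"


section \<open>Screen generic lightlike submanifolds\<close>

definition Bo ::
  "('m, 'e::euclidean_space) ambient \<Rightarrow> ('s, 'd::euclidean_space, 'm, 'e) submfd \<Rightarrow> 's \<Rightarrow> 'e set" where
  "Bo A M p = J A M p ` scr M p \<inter> scr M p"

definition B' ::
  "('m, 'e::euclidean_space) ambient \<Rightarrow> ('s, 'd::euclidean_space, 'm, 'e) submfd \<Rightarrow> 's \<Rightarrow> 'e set" where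
  "B' A M p = {v \<in> scr M p. \<forall>u\<in>Bo A M p. ip A M p v u = 0}"

definition screen_generic ::
  "('m::{t2_space, second_countable_topology}, 'e::euclidean_space) ambient \<Rightarrow>
   ('s::{t2_space, second_countable_topology}, 'd::euclidean_space, 'm, 'e) submfd \<Rightarrow> bool" where
  "screen_generic A M \<longleftrightarrow> lightlike_submanifold A M \<and>
     (\<forall>p. J A M p ` Rad A M p = Rad A M p) \<and>
     (\<exists>k. subbundle A M k (Bo A M)) \<and>
     (\<forall>p. \<forall>u\<in>Bo A M p. (\<forall>v\<in>Bo A M p. ip A M p u v = 0) \<longrightarrow> u = 0) \<and>
     \<comment> \<open>non-inclusions of bundles, not of every fibre\<close>
     ((\<exists>p. B' A M p \<noteq> {0}) \<longrightarrow>
        \<not> (\<forall>p. J A M p ` B' A M p \<subseteq> scr M p) \<and> \<not> (\<forall>p. J A M p ` B' A M p \<subseteq> scrt M p)) \<and>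
     (\<forall>Y\<in>sections A M (B' A M).
        fJ A M Y \<in> sections A M (B' A M) \<and> wJ A M Y \<in> sections A M (scrt M))"

text \<open>\<open>\<Omega>\<^sub>Y Z\<close> is automatically smooth, so being a section of \<open>B'\<close> is a pointwise condition.\<close>

definition B'_parallel ::
  "('m, 'e::euclidean_space) ambient \<Rightarrow> ('s, 'd::euclidean_space, 'm, 'e) submfd \<Rightarrow> bool" where
  "B'_parallel A M \<longleftrightarrow>
     (\<forall>Y\<in>sections A M (B' A M). \<forall>Z\<in>sections A M (B' A M). \<forall>p. Omega A M Y Z p \<in> B' A M p)"

end

theory Submission
  imports Defs
begin

text \<open>
  Since \<open>\<nabla>J = 0\<close> along the submanifold, \<open>\<Omega>\<^sub>Y(JZ)\<close> and \<open>J(\<Omega>\<^sub>Y Z)\<close> (ambient connection) differ by a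
  combination of \<open>Y\<close> and \<open>JY\<close>.  For \<open>u\<close> in \<open>B\<^sub>o\<close> or \<open>ltr(TM)\<close>, both \<open>J\<close>-invariant and orthogonal to
  \<open>B'\<close>, the bronze identity \<open>\<langle>v, u\<rangle> = \<langle>Jv, Ju\<rangle> - 3\<langle>Jv, u\<rangle>\<close> therefore turns \<open>\<langle>\<Omega>\<^sub>Y Z, u\<rangle>\<close> into
  \<open>\<langle>\<Omega>\<^sub>Y(JZ), Ju\<rangle> - 3\<langle>\<Omega>\<^sub>Y(JZ), u\<rangle>\<close>, and splitting \<open>JZ = fZ + wZ\<close> gives the two conditions pointwise.
  The conditions quantify over global sections, so every vector of \<open>B\<^sub>o\<close> and \<open>ltr(TM)\<close> is extended to
  one by a cut-off function.
\<close>

section \<open>Calculus of smooth maps\<close>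

lemma frechet_derivative_eqI:
  "(f has_derivative f') (at x) \<Longrightarrow> frechet_derivative f (at x) = f'"
  by (metis frechet_derivative_at)

text \<open>\<open>frechet_derivative\<close> at a point sees only the germ of a function there;
  openness of \<open>S\<close> makes agreement on \<open>S\<close> determine that germ at every
  order.\<close>

lemma Ck_on_cong:
  fixes S :: "'a::euclidean_space set" and f g :: "'a \<Rightarrow> 'b::real_normed_vector"
  assumes "open S" "\<And>x. x \<in> S \<Longrightarrow> f x = g x" "Ck_on k S f"
  shows "Ck_on k S g"
  using assms(2,3)
proof (induction k arbitrary: f g)
  case 0
  then show ?case by (auto cong: continuous_on_cong_simp)
next
  case (Suc k)
  have *: "(g has_derivative frechet_derivative f (at x)) (at x)" if "x \<in> S" for x
  proof (rule has_derivative_transform_within_open[OF _ assms(1) that])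
    show "(f has_derivative frechet_derivative f (at x)) (at x)"
      using Suc.prems(2) that by (simp flip: frechet_derivative_works)
  qed (use Suc.prems in auto)
  have "Ck_on k S (\<lambda>x. frechet_derivative g (at x) v)" for v
    by (rule Suc.IH[of "\<lambda>x. frechet_derivative f (at x) v"])
       (use Suc.prems(2) frechet_derivative_eqI[OF *] in auto)
  with * show ?case by (auto simp: differentiable_def)
qed

lemma smooth_on_cong:
  "\<lbrakk>open S; smooth_on S f; \<And>x. x \<in> S \<Longrightarrow> f x = g x\<rbrakk> \<Longrightarrow> smooth_on S g"
  unfolding smooth_on_def using Ck_on_cong by blast

text \<open>This is the gluing principle for functions defined by cases: smoothness is checked
  separately on the pieces of an open cover.\<close>

lemma Ck_on_local:
  fixes S :: "'a::euclidean_space set" and f :: "'a \<Rightarrow> 'b::real_normed_vector"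
  assumes "\<And>x. x \<in> S \<Longrightarrow> \<exists>T. open T \<and> x \<in> T \<and> Ck_on k T f"
  shows "Ck_on k S f"
  using assms
proof (induction k arbitrary: f)
  case 0
  then show ?case
    by (auto simp: continuous_on_eq_continuous_within)
       (metis continuous_at_imp_continuous_at_within at_within_open)
next
  case (Suc k)
  then show ?case by (force intro!: Suc.IH)
qed

lemma smooth_on_local:
  assumes "\<And>x. x \<in> S \<Longrightarrow> \<exists>T. open T \<and> x \<in> T \<and> smooth_on T f"
  shows "smooth_on S f"
  unfolding smooth_on_def
  by (intro allI Ck_on_local) (meson assms smooth_on_def)

lemma Ck_on_subset: "Ck_on k S f \<Longrightarrow> T \<subseteq> S \<Longrightarrow> Ck_on k T f"
  by (induction k arbitrary: f) (auto intro: continuous_on_subset)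

lemma smooth_on_subset: "smooth_on S f \<Longrightarrow> T \<subseteq> S \<Longrightarrow> smooth_on T f"
  unfolding smooth_on_def using Ck_on_subset by blast

lemma Ck_on_Suc_D: "Ck_on (Suc k) S f \<Longrightarrow> Ck_on k S f"
proof (induction k arbitrary: f)
  case 0
  then show ?case
    by (simp add: continuous_at_imp_continuous_on differentiable_imp_continuous_within)
qed simp

lemma smooth_on_differentiable: "smooth_on S f \<Longrightarrow> x \<in> S \<Longrightarrow> f differentiable at x"
  unfolding smooth_on_def by (metis Ck_on.simps(2))

lemma smooth_on_has_derivative:
  "smooth_on S f \<Longrightarrow> x \<in> S \<Longrightarrow> (f has_derivative frechet_derivative f (at x)) (at x)"
  using smooth_on_differentiable frechet_derivative_works by blast

lemma smooth_on_derivative: "smooth_on S f \<Longrightarrow> smooth_on S (\<lambda>x. frechet_derivative f (at x) v)"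
  unfolding smooth_on_def by (metis Ck_on.simps(2))

section \<open>Closure properties of smooth maps\<close>

lemma Ck_on_const: "Ck_on k S (\<lambda>_. c)"
  by (induction k arbitrary: c) auto

lemma smooth_on_const: "smooth_on S (\<lambda>_. c)"
  by (simp add: smooth_on_def Ck_on_const)

lemma Ck_on_bounded_linear:
  assumes "bounded_linear L" "open S" "Ck_on k S f"
  shows "Ck_on k S (\<lambda>x. L (f x))"
  using assms(3)
proof (induction k arbitrary: f)
  case 0
  then show ?case by (simp add: bounded_linear.continuous_on[OF assms(1)])
next
  case (Suc k)
  have *: "((\<lambda>x. L (f x)) has_derivative (\<lambda>v. L (frechet_derivative f (at x) v))) (at x)"
    if "x \<in> S" for x
    using Suc.prems that
    by (intro bounded_linear.has_derivative[OF assms(1)]) (simp flip: frechet_derivative_works)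
  show ?case
    using * Suc.prems Suc.IH frechet_derivative_eqI[OF *]
    by (auto intro: Ck_on_cong[OF assms(2)] simp: differentiable_def)
qed

lemma smooth_on_bounded_linear:
  "bounded_linear L \<Longrightarrow> open S \<Longrightarrow> smooth_on S f \<Longrightarrow> smooth_on S (\<lambda>x. L (f x))"
  by (simp add: smooth_on_def Ck_on_bounded_linear)

lemma Ck_on_add:
  assumes "open S" "Ck_on k S f" "Ck_on k S g"
  shows "Ck_on k S (\<lambda>x. f x + g x)"
  using assms(2,3)
proof (induction k arbitrary: f g)
  case 0
  then show ?case by (simp add: continuous_on_add)
next
  case (Suc k)
  have *: "((\<lambda>x. f x + g x) has_derivative
      (\<lambda>v. frechet_derivative f (at x) v + frechet_derivative g (at x) v)) (at x)"
    if "x \<in> S" for x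
    using Suc.prems that by (intro has_derivative_add) (simp_all flip: frechet_derivative_works)
  have "Ck_on k S (\<lambda>x. frechet_derivative (\<lambda>x. f x + g x) (at x) v)" for v
    by (rule Ck_on_cong[OF assms(1) _ Suc.IH])
      (use Suc.prems frechet_derivative_eqI[OF *] in auto)
  with * show ?case by (auto simp: differentiable_def)
qed

lemma smooth_on_add:
  "open S \<Longrightarrow> smooth_on S f \<Longrightarrow> smooth_on S g \<Longrightarrow> smooth_on S (\<lambda>x. f x + g x)"
  by (simp add: smooth_on_def Ck_on_add)

lemma Ck_on_sum:
  "open S \<Longrightarrow> (\<And>i. i \<in> I \<Longrightarrow> Ck_on k S (f i)) \<Longrightarrow> Ck_on k S (\<lambda>x. \<Sum>i\<in>I. f i x)"
  by (induction I rule: infinite_finite_induct) (auto simp: Ck_on_const intro: Ck_on_add)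

lemma smooth_on_sum:
  "open S \<Longrightarrow> (\<And>i. i \<in> I \<Longrightarrow> smooth_on S (f i)) \<Longrightarrow> smooth_on S (\<lambda>x. \<Sum>i\<in>I. f i x)"
  by (simp add: smooth_on_def Ck_on_sum)

lemma Ck_on_bilinear:
  assumes bb: "bounded_bilinear bl" and "open S" "Ck_on k S f" "Ck_on k S g"
  shows "Ck_on k S (\<lambda>x. bl (f x) (g x))"
  using assms(3,4)
proof (induction k arbitrary: f g)
  case 0
  then show ?case by (simp add: bounded_bilinear.continuous_on[OF bb])
next
  case (Suc k)
  have *: "((\<lambda>x. bl (f x) (g x)) has_derivative
      (\<lambda>v. bl (f x) (frechet_derivative g (at x) v) + bl (frechet_derivative f (at x) v) (g x)))
      (at x)"
    if "x \<in> S" for x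
    using Suc.prems that
    by (intro bounded_bilinear.FDERIV[OF bb]) (simp_all flip: frechet_derivative_works)
  \<comment> \<open>Each summand of the product rule keeps one factor undifferentiated, so
    \<open>Ck_on_Suc_D\<close> first lowers that factor to order \<open>k\<close>.\<close>
  have "Ck_on k S (\<lambda>x. frechet_derivative (\<lambda>x. bl (f x) (g x)) (at x) v)" for v
    by (rule Ck_on_cong[OF assms(2) _ Ck_on_add[OF assms(2)
            Suc.IH[of f "\<lambda>x. frechet_derivative g (at x) v"]
            Suc.IH[of "\<lambda>x. frechet_derivative f (at x) v" g]]])
      (use Suc.prems[THEN Ck_on_Suc_D] Suc.prems frechet_derivative_eqI[OF *] in auto)
  with * show ?case by (auto simp: differentiable_def)
qed

lemma smooth_on_bilinear:
  "bounded_bilinear bl \<Longrightarrow> open S \<Longrightarrow> smooth_on S f \<Longrightarrow> smooth_on S g \<Longrightarrow>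
    smooth_on S (\<lambda>x. bl (f x) (g x))"
  by (simp add: smooth_on_def Ck_on_bilinear)

lemmas smooth_on_scaleR = smooth_on_bilinear[OF bounded_bilinear_scaleR]
lemmas smooth_on_inner = smooth_on_bilinear[OF bounded_bilinear_inner]

lemma linear_euclidean_sum:
  fixes L :: "'a::euclidean_space \<Rightarrow> 'b::real_vector"
  shows "linear L \<Longrightarrow> L v = (\<Sum>b\<in>Basis. (v \<bullet> b) *\<^sub>R L b)"
  by (metis (mono_tags, lifting) euclidean_representation linear_sum linear_cmul sum.cong)

lemma Ck_on_compose:
  fixes f :: "'a::euclidean_space \<Rightarrow> 'b::euclidean_space" and g :: "'b \<Rightarrow> 'c::real_normed_vector"
  assumes "open S" "f ` S \<subseteq> T" "Ck_on k T g" "Ck_on k S f"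
  shows "Ck_on k S (\<lambda>x. g (f x))"
  using assms(3,4)
proof (induction k arbitrary: g)
  case 0
  then show ?case using assms(2) by (auto intro: continuous_on_compose2)
next
  case (Suc k)
  \<comment> \<open>In the chain rule the derivative of \<open>g\<close> is evaluated at a direction
    that varies with \<open>x\<close>. Expanding this direction in the basis leaves only derivatives
    of \<open>g\<close> in fixed directions, composed with \<open>f\<close>, to which the induction
    hypothesis applies.\<close>
  let ?D = "\<lambda>v x. \<Sum>b\<in>Basis. (frechet_derivative f (at x) v \<bullet> b) *\<^sub>R frechet_derivative g (at (f x)) b"
  have *: "((\<lambda>x. g (f x)) has_derivative
      (\<lambda>v. frechet_derivative g (at (f x)) (frechet_derivative f (at x) v))) (at x)"
    if "x \<in> S" for x
    using Suc.prems that assms(2)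
    by (intro has_derivative_compose[of f _ x UNIV g])
       (auto simp flip: frechet_derivative_works)
  have D: "frechet_derivative (\<lambda>x. g (f x)) (at x) v = ?D v x" if "x \<in> S" for x v
    unfolding frechet_derivative_eqI[OF *[OF that]]
    by (rule linear_euclidean_sum, rule linear_frechet_derivative)
       (use Suc.prems that assms(2) in auto)
  have "Ck_on k S (?D v)" for v
  proof (intro Ck_on_sum Ck_on_bilinear[OF bounded_bilinear_scaleR] assms(1))
    show "Ck_on k S (\<lambda>x. frechet_derivative f (at x) v \<bullet> b)" for b
      by (rule Ck_on_bounded_linear[OF bounded_linear_inner_left assms(1)]) (use Suc.prems in auto)
    show "Ck_on k S (\<lambda>x. frechet_derivative g (at (f x)) b)" for b
      using Suc.IH[of "\<lambda>y. frechet_derivative g (at y) b"] Suc.prems Ck_on_Suc_D[OF Suc.prems(2)]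
      by auto
  qed
  then have "Ck_on k S (\<lambda>x. frechet_derivative (\<lambda>x. g (f x)) (at x) v)" for v
    by (rule Ck_on_cong[OF assms(1), rotated]) (simp add: D)
  with * show ?case by (auto simp: differentiable_def)
qed

lemma smooth_on_compose:
  fixes f :: "'a::euclidean_space \<Rightarrow> 'b::euclidean_space"
  shows "open S \<Longrightarrow> f ` S \<subseteq> T \<Longrightarrow> smooth_on T g \<Longrightarrow> smooth_on S f \<Longrightarrow> smooth_on S (\<lambda>x. g (f x))"
  by (simp add: smooth_on_def Ck_on_compose)

lemma smooth_on_ident: "smooth_on S (\<lambda>x. x)"
proof -
  have "Ck_on k S (\<lambda>x. x)" for k
    by (cases k) (auto simp: Ck_on_const)
  then show ?thesis by (simp add: smooth_on_def)
qed

text \<open>The case \<open>n = 0\<close> is the classical smooth function exp(-1/x) that is flat at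
  the origin. The extra powers of 1/x make the family closed under differentiation up to linear
  combinations, so all orders are handled by one induction.\<close>

definition flat :: "nat \<Rightarrow> real \<Rightarrow> real" where
  "flat n x = (if x > 0 then inverse x ^ n * exp (- inverse x) else 0)"

text \<open>From the right, the substitution t = 1/x reduces the limit to t^n / exp t tending to 0
  at infinity; from the left the function is zero.\<close>

lemma flat_tendsto_0: "(flat n \<longlongrightarrow> 0) (at 0)"
proof (rule filterlim_split_at)
  have "((\<lambda>x. flat n x) \<longlongrightarrow> 0) (at_left 0) \<longleftrightarrow> ((\<lambda>_::real. 0::real) \<longlongrightarrow> 0) (at_left 0)"
    by (rule filterlim_cong)
      (auto simp: flat_def eventually_at_filter intro!: always_eventually)
  then show "(flat n \<longlongrightarrow> 0) (at_left 0)" by simp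
  have "((\<lambda>x. inverse x ^ n / exp (inverse x)) \<longlongrightarrow> (0::real)) (at_right 0)"
    by (rule filterlim_compose[OF tendsto_power_div_exp_0 filterlim_inverse_at_top_right])
  moreover have "((\<lambda>x. flat n x) \<longlongrightarrow> 0) (at_right 0) \<longleftrightarrow>
      ((\<lambda>x. inverse x ^ n / exp (inverse x)) \<longlongrightarrow> (0::real)) (at_right 0)"
    by (rule filterlim_cong)
      (auto simp: flat_def eventually_at_filter exp_minus divide_inverse intro!: always_eventually)
  ultimately show "(flat n \<longlongrightarrow> 0) (at_right 0)" by simp
qed

lemma flat_has_derivative:
  "(flat n has_real_derivative (flat (n + 2) x - real n * flat (n + 1) x)) (at x)"
proof -
  consider "x > 0" | "x < 0" | "x = 0" by linarith
  then show ?thesis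
  proof cases
    case 1
    have "((\<lambda>x. inverse x ^ n * exp (- inverse x)) has_real_derivative
        (flat (n + 2) x - real n * flat (n + 1) x)) (at x)"
    proof (rule DERIV_cong[OF DERIV_mult[OF DERIV_power]])
      show "(inverse has_real_derivative - (inverse x ^ 2)) (at x)"
        using 1 by (auto intro!: derivative_eq_intros simp: power2_eq_square)
      show "((\<lambda>x. exp (- inverse x)) has_real_derivative exp (- inverse x) * inverse x ^ 2) (at x)"
        using 1 by (auto intro!: derivative_eq_intros simp: power2_eq_square)
    qed (use 1 in \<open>cases n; auto simp: flat_def algebra_simps power2_eq_square\<close>)
    then show ?thesis
      by (rule has_field_derivative_transform_within_open[where S="{0<..}"])
        (use 1 in \<open>auto simp: flat_def\<close>)
  next
    case 2
    have "((\<lambda>x. 0) has_real_derivative (flat (n + 2) x - real n * flat (n + 1) x)) (at x)"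
      using 2 by (auto simp: flat_def)
    then show ?thesis
      by (rule has_field_derivative_transform_within_open[where S="{..<0}"])
        (use 2 in \<open>auto simp: flat_def\<close>)
  next
    case 3
    \<comment> \<open>At the origin the difference quotient of \<open>flat n\<close> is
      \<open>flat (Suc n)\<close> itself, so the derivative there is the limit already
      computed.\<close>
    have "((\<lambda>h. (flat n (0 + h) - flat n 0) / h) \<longlongrightarrow> 0) (at 0) \<longleftrightarrow> (flat (Suc n) \<longlongrightarrow> 0) (at 0)"
      by (rule filterlim_cong)
        (auto simp: flat_def eventually_at_filter field_simps intro!: always_eventually)
    then show ?thesis
      using flat_tendsto_0[of "Suc n"] 3 by (simp add: DERIV_def flat_def)
  qed
qed

lemma smooth_on_flat: "smooth_on S (flat n)"
proof -
  have D: "frechet_derivative (flat n) (at x) = (\<lambda>v. (flat (n + 2) x + (- real n) *\<^sub>R flat (n + 1) x) * v)"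
    for n x
    using flat_has_derivative[of n x]
    by (intro frechet_derivative_eqI) (simp add: has_field_derivative_def)
  have diff: "flat n differentiable at x" for n x
    using flat_has_derivative[of n x] real_differentiable_def by blast
  have "Ck_on k UNIV (flat n)" for k n
  proof (induction k arbitrary: n)
    case 0
    show ?case by (simp add: continuous_at_imp_continuous_on differentiable_imp_continuous_within diff)
  next
    case (Suc k)
    show ?case unfolding Ck_on.simps D
      by (intro conjI ballI diff allI Ck_on_bilinear[OF bounded_bilinear_mult] Ck_on_add
          Ck_on_bounded_linear[OF bounded_linear_scaleR_right] Suc Ck_on_const open_UNIV)
  qed
  then show ?thesis unfolding smooth_on_def using Ck_on_subset by blast
qed

text \<open>The argument r^2 - |x - c|^2 is positive exactly inside the ball, so
  \<open>flat 0\<close> of it vanishes outside; dividing by its value at the centre normalises it to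
  1 there.\<close>

lemma smooth_bump:
  fixes c :: "'a::euclidean_space"
  assumes "r > 0"
  obtains \<beta> :: "'a \<Rightarrow> real" where "smooth_on UNIV \<beta>" "\<beta> c = 1" "\<And>x. x \<notin> cball c r \<Longrightarrow> \<beta> x = 0"
proof
  let ?q = "\<lambda>x. r\<^sup>2 + - ((x + - c) \<bullet> (x + - c))"
  let ?\<beta> = "\<lambda>x. flat 0 (?q x) / flat 0 (r\<^sup>2)"
  have "smooth_on UNIV ?q"
    by (intro smooth_on_add smooth_on_const smooth_on_ident smooth_on_inner open_UNIV
        smooth_on_bounded_linear[OF bounded_linear_minus[OF bounded_linear_ident]])
  then show "smooth_on UNIV ?\<beta>"
    by (intro smooth_on_bounded_linear[OF bounded_linear_divide]
        smooth_on_compose[OF _ _ smooth_on_flat]) auto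
  show "?\<beta> c = 1" using assms by (simp add: flat_def)
  show "?\<beta> x = 0" if "x \<notin> cball c r" for x
  proof -
    have "r\<^sup>2 < (dist x c)\<^sup>2"
      using that assms by (intro power_strict_mono) (auto simp: dist_commute)
    then show ?thesis by (simp add: flat_def dist_norm power2_norm_eq_inner)
  qed
qed

section \<open>Charts, cut-off functions and extension of local fields\<close>

context
  fixes A :: "('m::{t2_space, second_countable_topology}, 'e::euclidean_space) atlas"
  assumes mf: "smooth_manifold A"
begin

lemma chart_point: "p \<in> cdom A p"
  using mf by (simp add: smooth_manifold_def)

lemma chart_open: "open (cdom A p)"
  using mf by (simp add: smooth_manifold_def)

lemma chart_homeomorphism:
  "homeomorphism (cdom A p) (cmap A p ` cdom A p) (cmap A p) (cinv A p)"
  using mf by (simp add: smooth_manifold_def)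

lemma cinv_cmap [simp]: "x \<in> cdom A p \<Longrightarrow> cinv A p (cmap A p x) = x"
  using chart_homeomorphism by (rule homeomorphism_apply1)

lemma open_chart_image:
  assumes "open U" shows "open (cmap A p ` (cdom A p \<inter> U))"
proof -
  have "openin (top_of_set (cmap A p ` cdom A p)) (cmap A p ` (cdom A p \<inter> U))"
    by (rule homeomorphism_imp_open_map[OF chart_homeomorphism]) (use assms in auto)
  moreover have "open (cmap A p ` cdom A p)"
    using mf by (simp add: smooth_manifold_def)
  ultimately show ?thesis using openin_open_trans by blast
qed

lemma smooth_transition: "smooth_on (cmap A p ` (cdom A p \<inter> cdom A q)) (\<lambda>u. cmap A q (cinv A p u))"
  using mf by (simp add: smooth_manifold_def comp_def)

lemma transition_has_derivative:
  assumes "x \<in> cdom A p" "x \<in> cdom A q"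
  shows "((\<lambda>u. cmap A q (cinv A p u)) has_derivative
          frechet_derivative (\<lambda>u. cmap A q (cinv A p u)) (at (cmap A p x))) (at (cmap A p x))"
  by (rule smooth_on_has_derivative[OF smooth_transition[of p q]]) (use assms in auto)

lemma coord_alt: "coord A q x = frechet_derivative (\<lambda>u. cmap A q (cinv A x u)) (at (cmap A x x))"
  by (auto simp: coord_def comp_def)

lemma linear_coord: "x \<in> cdom A q \<Longrightarrow> linear (coord A q x)"
  unfolding coord_alt using transition_has_derivative[OF chart_point] has_derivative_linear by blast

lemma transition_self_has_derivative:
  "x \<in> cdom A q \<Longrightarrow> ((\<lambda>u. cmap A q (cinv A q u)) has_derivative (\<lambda>v. v)) (at (cmap A q x))"
  by (rule has_derivative_transform_within_open[OF has_derivative_ident,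
        where s="cmap A q ` (cdom A q \<inter> UNIV)"])
     (use open_chart_image[OF open_UNIV] in auto)

lemma coord_self: "coord A x x = (\<lambda>v. v)"
  unfolding coord_alt
  by (rule frechet_derivative_eqI[OF transition_self_has_derivative[OF chart_point]])

text \<open>A bump function in the chart at \<open>p\<close> is pulled back and extended by zero.
  The closed set \<open>K\<close> is kept in the conclusion because its open complement, where
  \<open>\<phi>\<close> vanishes, together with \<open>V\<close> covers the manifold.\<close>

lemma smooth_cutoff:
  assumes "open V" "p \<in> V"
  obtains \<phi> K where "smooth_fun A \<phi>" "\<phi> p = 1" "closed K" "K \<subseteq> V" "\<And>x. x \<notin> K \<Longrightarrow> \<phi> x = 0"
proof -
  let ?W = "cmap A p ` (cdom A p \<inter> V)"
  have "open ?W" "cmap A p p \<in> ?W"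
    using open_chart_image assms chart_point by auto
  then obtain r where r: "r > 0" "cball (cmap A p p) r \<subseteq> ?W"
    using open_contains_cball by blast
  obtain \<beta> :: "'e \<Rightarrow> real" where \<beta>: "smooth_on UNIV \<beta>" "\<beta> (cmap A p p) = 1"
      "\<And>x. x \<notin> cball (cmap A p p) r \<Longrightarrow> \<beta> x = 0"
    using smooth_bump[OF r(1), of "cmap A p p"] by blast
  define K where "K = cinv A p ` cball (cmap A p p) r"
  define \<phi> where "\<phi> x = (if x \<in> cdom A p then \<beta> (cmap A p x) else 0)" for x
  have KV: "K \<subseteq> cdom A p \<inter> V" using r(2) unfolding K_def by fastforce
  \<comment> \<open>\<open>K\<close> is the continuous image of a compact ball, and compact sets are
    closed because the manifold is Hausdorff.\<close>
  have "continuous_on (cball (cmap A p p) r) (cinv A p)"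
    by (rule continuous_on_subset[OF homeomorphism_cont2[OF chart_homeomorphism]]) (use r in auto)
  then have "closed K"
    unfolding K_def by (intro compact_imp_closed compact_continuous_image compact_cball)
  have \<phi>0: "\<phi> x = 0" if "x \<notin> K" for x
    using that \<beta>(3)[of "cmap A p x"] unfolding \<phi>_def K_def by (metis cinv_cmap image_eqI)
  have "smooth_on (cmap A q ` cdom A q) (\<lambda>u. \<phi> (cinv A q u))" for q
  proof (rule smooth_on_local)
    fix u assume "u \<in> cmap A q ` cdom A q"
    then obtain x where x: "x \<in> cdom A q" "u = cmap A q x" by blast
    show "\<exists>T. open T \<and> u \<in> T \<and> smooth_on T (\<lambda>u. \<phi> (cinv A q u))"
    proof (cases "x \<in> cdom A p")
      case True
      let ?T = "cmap A q ` (cdom A q \<inter> cdom A p)"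
      have "open ?T" by (rule open_chart_image[OF chart_open])
      moreover from this have "smooth_on ?T (\<lambda>u. \<beta> (cmap A p (cinv A q u)))"
        by (rule smooth_on_compose[OF _ _ \<beta>(1) smooth_transition]) simp
      ultimately have "smooth_on ?T (\<lambda>u. \<phi> (cinv A q u))"
        by (rule smooth_on_cong[OF _ _]) (auto simp: \<phi>_def)
      with \<open>open ?T\<close> True x show ?thesis by blast
    next
      case False
      \<comment> \<open>Since \<open>K\<close> lies inside the chart domain of \<open>p\<close>, a
        point outside that domain has a neighbourhood missing \<open>K\<close>, on which
        \<open>\<phi>\<close> is zero.\<close>
      let ?T = "cmap A q ` (cdom A q \<inter> - K)"
      have "open ?T" by (rule open_chart_image) (use \<open>closed K\<close> in auto)
      then have "smooth_on ?T (\<lambda>u. \<phi> (cinv A q u))"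
        by (rule smooth_on_cong[OF _ smooth_on_const[of _ 0]]) (auto simp: \<phi>0)
      moreover have "u \<in> ?T" using x False KV by blast
      ultimately show ?thesis using \<open>open ?T\<close> by blast
    qed
  qed
  then have "smooth_fun A \<phi>" by (simp add: smooth_fun_def comp_def)
  moreover have "\<phi> p = 1" using \<beta>(2) chart_point by (simp add: \<phi>_def)
  ultimately show ?thesis using that \<open>closed K\<close> KV \<phi>0 by blast
qed

text \<open>This is the coordinate field of the chart \<open>A q\<close> in the direction
  \<open>b\<close>. Tangent vectors at \<open>x\<close> are stored in the components of
  \<open>A x\<close>, hence the derivative of the transition from \<open>A q\<close> to
  \<open>A x\<close>.\<close>

definition chart_frame :: "'m \<Rightarrow> 'e \<Rightarrow> 'm \<Rightarrow> 'e" where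
  "chart_frame q b x = frechet_derivative (\<lambda>u. cmap A x (cinv A q u)) (at (cmap A q x)) b"

text \<open>The transitions from \<open>q\<close> to \<open>x\<close> and from \<open>x\<close> to
  \<open>q'\<close> compose to the one from \<open>q\<close> to \<open>q'\<close>. The result no
  longer uses a chart that varies with the point, which makes smoothness in \<open>x\<close>
  visible.\<close>

lemma coord_chart_frame:
  assumes "x \<in> cdom A q" "x \<in> cdom A q'"
  shows "coord A q' x (chart_frame q b x) =
         frechet_derivative (\<lambda>u. cmap A q' (cinv A q u)) (at (cmap A q x)) b"
proof -
  let ?f = "\<lambda>u. cmap A x (cinv A q u)" and ?g = "\<lambda>u. cmap A q' (cinv A x u)"
  let ?T = "cmap A q ` (cdom A q \<inter> cdom A x)"
  have f: "(?f has_derivative frechet_derivative ?f (at (cmap A q x))) (at (cmap A q x))"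
    by (rule transition_has_derivative) (use assms chart_point in auto)
  have g: "(?g has_derivative coord A q' x) (at (?f (cmap A q x)))"
    unfolding coord_alt using assms transition_has_derivative[OF chart_point assms(2)] by simp
  have "((\<lambda>u. ?g (?f u)) has_derivative
      (\<lambda>v. coord A q' x (frechet_derivative ?f (at (cmap A q x)) v))) (at (cmap A q x))"
    using has_derivative_compose[OF f g] .
  then have "((\<lambda>u. cmap A q' (cinv A q u)) has_derivative
      (\<lambda>v. coord A q' x (frechet_derivative ?f (at (cmap A q x)) v))) (at (cmap A q x))"
    by (rule has_derivative_transform_within_open[where s="?T"])
      (use assms chart_point open_chart_image[OF chart_open] in auto)
  then show ?thesis by (simp add: chart_frame_def frechet_derivative_eqI)
qed

lemma coord_chart_frame_self:
  "x \<in> cdom A q \<Longrightarrow> coord A q x (chart_frame q b x) = b"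
  by (simp add: coord_chart_frame frechet_derivative_eqI[OF transition_self_has_derivative])

lemma smooth_chart_frame: "smooth_field_on A A id (cdom A q) (chart_frame q b)"
  unfolding smooth_field_on_def
proof (intro allI)
  fix p q'
  let ?S = "cmap A p ` (cdom A p \<inter> (cdom A q' \<inter> cdom A q))"
  have S: "open ?S" by (intro open_chart_image open_Int chart_open)
  have "smooth_on ?S (\<lambda>u. frechet_derivative (\<lambda>u. cmap A q' (cinv A q u)) (at (cmap A q (cinv A p u))) b)"
    by (rule smooth_on_compose[OF S _ smooth_on_derivative[OF smooth_transition]
          smooth_on_subset[OF smooth_transition]]) auto
  then have "smooth_on ?S (\<lambda>u. coord A q' (id (cinv A p u)) (chart_frame q b (cinv A p u)))"
    by (rule smooth_on_cong[OF S]) (auto simp: coord_chart_frame)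
  then show "smooth_on (cmap A p ` (cdom A p \<inter> id -` cdom A q' \<inter> cdom A q))
      (\<lambda>u. coord A q' (id (cinv A p u)) (chart_frame q b (cinv A p u)))"
    by (simp add: Int_assoc)
qed

end

section \<open>Smooth fields along a map: sums and cut-offs\<close>

context
  fixes A :: "('m::{t2_space, second_countable_topology}, 'e::euclidean_space) atlas"
    and B :: "('s::{t2_space, second_countable_topology}, 'd::euclidean_space) atlas"
    and F :: "'s \<Rightarrow> 'm"
  assumes mfA: "smooth_manifold A" and mfB: "smooth_manifold B" and contF: "continuous_on UNIV F"
begin

lemma open_field_domain:
  assumes "open V" shows "open (cmap B p ` (cdom B p \<inter> F -` cdom A q \<inter> V))"
proof -
  have "open (F -` cdom A q)"
    using contF chart_open[OF mfA] by (rule open_vimage[rotated])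
  then show ?thesis
    using open_chart_image[OF mfB open_Int[OF _ assms]] by (simp add: Int_assoc)
qed

lemma smooth_field_on_sum:
  assumes "open V" "\<And>i. i \<in> I \<Longrightarrow> smooth_field_on B A F V (e i)"
  shows "smooth_field_on B A F V (\<lambda>x. \<Sum>i\<in>I. c i *\<^sub>R e i x)"
  unfolding smooth_field_on_def
proof (intro allI)
  fix p q
  let ?S = "cmap B p ` (cdom B p \<inter> F -` cdom A q \<inter> V)"
  note S = open_field_domain[OF assms(1), of p q]
  have "smooth_on ?S (\<lambda>u. \<Sum>i\<in>I. c i *\<^sub>R coord A q (F (cinv B p u)) (e i (cinv B p u)))"
    by (intro smooth_on_sum smooth_on_bounded_linear[OF bounded_linear_scaleR_right] S)
       (use assms(2) in \<open>auto simp: smooth_field_on_def\<close>)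
  then show "smooth_on ?S (\<lambda>u. coord A q (F (cinv B p u)) (\<Sum>i\<in>I. c i *\<^sub>R e i (cinv B p u)))"
    by (rule smooth_on_cong[OF S])
       (auto simp: mfB linear_sum[OF linear_coord[OF mfA]] linear_cmul[OF linear_coord[OF mfA]])
qed

text \<open>On \<open>V\<close> the product is smooth, off \<open>K\<close> it is zero, and these
  two open sets cover everything; thus a local field becomes a global one.\<close>

lemma smooth_field_cutoff:
  assumes "open V" "smooth_field_on B A F V Y" "smooth_fun B \<phi>"
    and "closed K" "K \<subseteq> V" "\<And>x. x \<notin> K \<Longrightarrow> \<phi> x = 0"
  shows "smooth_field_on B A F UNIV (\<lambda>x. \<phi> x *\<^sub>R Y x)"
  unfolding smooth_field_on_def
proof (intro allI)
  fix p q
  let ?Y = "\<lambda>u. coord A q (F (cinv B p u)) (\<phi> (cinv B p u) *\<^sub>R Y (cinv B p u))"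
  let ?S = "\<lambda>V. cmap B p ` (cdom B p \<inter> F -` cdom A q \<inter> V)"
  show "smooth_on (?S UNIV) ?Y"
  proof (rule smooth_on_local)
    fix u assume "u \<in> ?S UNIV"
    then obtain x where x: "x \<in> cdom B p" "F x \<in> cdom A q" "u = cmap B p x" by blast
    show "\<exists>T. open T \<and> u \<in> T \<and> smooth_on T ?Y"
    proof (cases "x \<in> V")
      case True
      note S = open_field_domain[OF assms(1), of p q]
      have "smooth_on (?S V) (\<lambda>u. \<phi> (cinv B p u) *\<^sub>R coord A q (F (cinv B p u)) (Y (cinv B p u)))"
      proof (rule smooth_on_scaleR[OF S])
        have "smooth_on (cmap B p ` cdom B p) (\<lambda>u. \<phi> (cinv B p u))"
          using assms(3) by (simp add: smooth_fun_def comp_def)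
        then show "smooth_on (?S V) (\<lambda>u. \<phi> (cinv B p u))"
          by (rule smooth_on_subset) auto
      qed (use assms(2) in \<open>auto simp: smooth_field_on_def\<close>)
      then have "smooth_on (?S V) ?Y"
        by (rule smooth_on_cong[OF S]) (auto simp: mfB linear_cmul[OF linear_coord[OF mfA]])
      with S x True show ?thesis by blast
    next
      case False
      have S: "open (?S (- K))" using assms(4) by (intro open_field_domain) auto
      have "smooth_on (?S (- K)) ?Y"
        by (rule smooth_on_cong[OF S smooth_on_const[of _ 0]])
           (auto simp: mfB assms(6) linear_0[OF linear_coord[OF mfA]])
      moreover have "u \<in> ?S (- K)" using x False assms(5) by blast
      ultimately show ?thesis using S by blast
    qed
  qed
qed

end

section \<open>Parallel endomorphisms along a map\<close>

text \<open>The coordinate fields of \<open>A q\<close> attain every component vector, so the linear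
  map is surjective, hence injective for reasons of dimension.\<close>

lemma inj_coord:
  assumes "smooth_manifold A" "x \<in> cdom A q" shows "inj (coord A q x)"
proof -
  have "surj (coord A q x)"
    by (rule surjI[where f="\<lambda>b. chart_frame A q b x"]) (rule coord_chart_frame_self[OF assms])
  then show ?thesis
    by (rule linear_surjective_imp_injective[OF linear_coord[OF assms]]) simp
qed

lemma chart_frame_self:
  assumes "smooth_manifold A" shows "chart_frame A q b q = b"
  using coord_chart_frame_self[OF assms chart_point[OF assms], of q b] coord_self[OF assms] by metis

lemma differential_id:
  assumes "smooth_manifold A" shows "differential A A id p = (\<lambda>v. v)"
  using frechet_derivative_eqI[OF transition_self_has_derivative[OF assms chart_point[OF assms]]]
  by (simp add: differential_def comp_def)

lemma nabla_id:
  assumes "smooth_manifold A"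
  shows "nabla A C A id X Y p =
    frechet_derivative (\<lambda>u. coord A p (cinv A p u) (Y (cinv A p u))) (at (cmap A p p)) (X p)
    + C p (X p) (Y p)"
proof -
  have "inv (\<lambda>v::'b. v) = (\<lambda>v. v)" using inv_id by (simp add: id_def)
  then show ?thesis by (simp only: nabla_def differential_id[OF assms] id_apply)
qed

lemma differential_has_derivative:
  assumes "smooth_manifold A" "smooth_manifold B" "smooth_map B A F"
  shows "((\<lambda>u. cmap A (F p) (F (cinv B p u))) has_derivative differential B A F p) (at (cmap B p p))"
  unfolding differential_def comp_def
proof (rule smooth_on_has_derivative)
  show "smooth_on (cmap B p ` (cdom B p \<inter> F -` cdom A (F p)))
      (\<lambda>u. cmap A (F p) (F (cinv B p u)))"
    using assms(3) by (simp add: smooth_map_def comp_def)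
qed (use chart_point[OF assms(1)] chart_point[OF assms(2)] in auto)

lemma field_has_derivative:
  assumes "smooth_manifold A" "smooth_manifold B" "smooth_field_on B A F UNIV Z"
  shows "((\<lambda>u. coord A (F p) (F (cinv B p u)) (Z (cinv B p u))) has_derivative
    frechet_derivative (\<lambda>u. coord A (F p) (F (cinv B p u)) (Z (cinv B p u))) (at (cmap B p p)))
    (at (cmap B p p))"
proof (rule smooth_on_has_derivative)
  show "smooth_on (cmap B p ` (cdom B p \<inter> F -` cdom A (F p)))
      (\<lambda>u. coord A (F p) (F (cinv B p u)) (Z (cinv B p u)))"
    using assms(3)[unfolded smooth_field_on_def, rule_format, of p "F p"] by simp
qed (use chart_point[OF assms(1)] chart_point[OF assms(2)] in auto)

lemma nabla_add:
  assumes A: "smooth_manifold A" and B: "smooth_manifold B" and F: "continuous_on UNIV F"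
    and C: "bilinear (C (F p))"
    and Y: "smooth_field_on B A F UNIV Y" and Z: "smooth_field_on B A F UNIV Z"
  shows "nabla A C B F X (\<lambda>x. Y x + Z x) p = nabla A C B F X Y p + nabla A C B F X Z p"
proof -
  let ?c = "\<lambda>Y u. coord A (F p) (F (cinv B p u)) (Y (cinv B p u))" and ?u = "cmap B p p"
  let ?S = "cmap B p ` (cdom B p \<inter> F -` cdom A (F p) \<inter> UNIV)"
  have "((\<lambda>u. ?c Y u + ?c Z u) has_derivative
      (\<lambda>v. frechet_derivative (?c Y) (at ?u) v + frechet_derivative (?c Z) (at ?u) v)) (at ?u)"
    by (intro has_derivative_add field_has_derivative A B Y Z)
  then have "(?c (\<lambda>x. Y x + Z x) has_derivative
      (\<lambda>v. frechet_derivative (?c Y) (at ?u) v + frechet_derivative (?c Z) (at ?u) v)) (at ?u)"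
  proof (rule has_derivative_transform_within_open[where s="?S"])
    show "open ?S" by (rule open_field_domain[OF A B F]) simp
    show "?u \<in> ?S" using chart_point[OF A] chart_point[OF B] by auto
    show "?c Y u + ?c Z u = ?c (\<lambda>x. Y x + Z x) u" if "u \<in> ?S" for u
      using that B by (auto simp: linear_add[OF linear_coord[OF A]])
  qed
  then show ?thesis
    by (simp add: nabla_def frechet_derivative_eqI bilinear_radd[OF C])
qed

text \<open>
  The endomorphism field is only known to commute with \<open>\<nabla>\<close> on global fields of the ambient
  manifold.  Near \<open>p\<close> a field along \<open>F\<close> is a combination, with differentiable coefficients, of
  cut-off coordinate fields composed with \<open>F\<close>, and both sides satisfy the same product rule.
\<close>

lemma nabla_parallel_endomorphism:
  fixes A :: "('m::{t2_space, second_countable_topology}, 'e::euclidean_space) atlas"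
    and B :: "('s::{t2_space, second_countable_topology}, 'd::euclidean_space) atlas"
  assumes A: "smooth_manifold A" and B: "smooth_manifold B" and F: "smooth_map B A F"
    and C: "\<And>q. bilinear (C q)" and P: "\<And>q. linear (P q)"
    and PV: "\<And>Y. Y \<in> vector_fields A \<Longrightarrow> (\<lambda>x. P x (Y x)) \<in> vector_fields A"
    and par: "\<And>X Y q. X \<in> vector_fields A \<Longrightarrow> Y \<in> vector_fields A \<Longrightarrow>
        nabla A C A id X (\<lambda>x. P x (Y x)) q = P q (nabla A C A id X Y q)"
    and inj: "inj (differential B A F p)" and X: "X p \<in> range (differential B A F p)"
    and Z: "smooth_field_on B A F UNIV Z"
  shows "nabla A C B F X (\<lambda>x. P (F x) (Z x)) p = P (F p) (nabla A C B F X Z p)"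
proof -
  define q where "q = F p"
  define u0 where "u0 = cmap B p p"
  have contF: "continuous_on UNIV F" using F by (simp add: smooth_map_def)
  obtain \<phi> K where \<phi>: "smooth_fun A \<phi>" "\<phi> q = 1" "closed K" "K \<subseteq> cdom A q" "\<And>x. x \<notin> K \<Longrightarrow> \<phi> x = 0"
    using smooth_cutoff[OF A chart_open[OF A] chart_point[OF A]] by metis
  \<comment> \<open>These are global fields, as the parallelism hypothesis demands, and they keep
    the value \<open>b\<close> at \<open>q\<close> because \<open>\<phi> q = 1\<close>.\<close>
  define E where "E b x = \<phi> x *\<^sub>R chart_frame A q b x" for b x
  have E: "E b \<in> vector_fields A" for b
    using smooth_field_cutoff[OF A A continuous_on_id' chart_open[OF A] smooth_chart_frame[OF A] \<phi>(1,3-5)]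
    by (simp add: vector_fields_def E_def[abs_def])
  have Eq: "E b q = b" for b by (simp add: E_def \<phi> chart_frame_self[OF A])
  have coordE: "coord A q x (E b x) = \<phi> x *\<^sub>R b" if "x \<in> cdom A q" for x b
    using that by (simp add: E_def linear_cmul[OF linear_coord[OF A]] coord_chart_frame_self[OF A])
  \<comment> \<open>The parameter \<open>G\<close> will be the identity and then \<open>P\<close>,
    so that the field and its image under the endomorphism share one computation.\<close>
  define \<eta> where "\<eta> G b y = coord A q (cinv A q y) (G (cinv A q y) (E b (cinv A q y)))"
    for G :: "'m \<Rightarrow> 'e \<Rightarrow> 'e" and b y
  define D\<eta> where "D\<eta> G b = frechet_derivative (\<eta> G b) (at (cmap A q q))" for G b
  define \<Phi> where "\<Phi> u = cmap A q (F (cinv B p u))" for u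
  define \<psi> where "\<psi> u = \<phi> (F (cinv B p u))" for u
  define \<zeta> where "\<zeta> G u = coord A q (F (cinv B p u)) (G (F (cinv B p u)) (Z (cinv B p u)))"
    for G :: "'m \<Rightarrow> 'e \<Rightarrow> 'e" and u
  \<comment> \<open>In the chart \<open>A q\<close> the field \<open>E b\<close> has components
    \<open>\<phi>\<close> times \<open>b\<close>; dividing the components of \<open>Z\<close> by
    \<open>\<psi>\<close> gives its coefficients with respect to the fields
    \<open>E b\<close>.\<close>
  define a where "a b u = (\<zeta> (\<lambda>_ v. v) u \<bullet> b) / \<psi> u" for b u
  define S where "S = cmap B p ` (cdom B p \<inter> F -` cdom A q \<inter> UNIV)"
  have S: "open S" unfolding S_def by (rule open_field_domain[OF A B contF]) simp
  have u0S: "u0 \<in> S" using chart_point[OF A] chart_point[OF B] by (auto simp: S_def u0_def q_def)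
  have pu0: "cinv B p u0 = p" by (simp add: u0_def B chart_point[OF B])
  have \<Phi>: "(\<Phi> has_derivative differential B A F p) (at u0)"
    unfolding \<Phi>_def q_def u0_def by (rule differential_has_derivative[OF A B F])
  have \<Phi>u0: "\<Phi> u0 = cmap A q q" by (simp add: \<Phi>_def pu0 q_def)
  obtain \<psi>' where \<psi>: "(\<psi> has_derivative \<psi>') (at u0)"
  proof -
    have "smooth_on (cmap A q ` cdom A q) (\<lambda>y. \<phi> (cinv A q y))"
      using \<phi>(1) by (simp add: smooth_fun_def comp_def)
    then have "((\<lambda>y. \<phi> (cinv A q y)) has_derivative
        frechet_derivative (\<lambda>y. \<phi> (cinv A q y)) (at (\<Phi> u0))) (at (\<Phi> u0))"
      by (rule smooth_on_has_derivative) (simp add: \<Phi>u0 chart_point[OF A])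
    from has_derivative_compose[OF \<Phi> this] show ?thesis
      by (intro that, rule has_derivative_transform_within_open[OF _ S u0S])
         (auto simp: \<Phi>_def \<psi>_def S_def A B)
  qed
  have \<psi>u0: "\<psi> u0 = 1" using \<phi> by (simp add: \<psi>_def pu0 q_def)
  \<comment> \<open>The quotients \<open>a\<close> represent \<open>Z\<close> only where
    \<open>\<psi>\<close> is nonzero, which holds near \<open>u0\<close> by continuity.\<close>
  obtain T where T: "open T" "u0 \<in> T" "\<And>u. u \<in> T \<Longrightarrow> \<psi> u \<noteq> 0"
  proof -
    have "(\<psi> \<longlongrightarrow> \<psi> u0) (nhds u0)"
      using has_derivative_continuous[OF \<psi>]
      by (simp only: isCont_def tendsto_at_iff_tendsto_nhds)
    then have "eventually (\<lambda>u. \<psi> u \<noteq> 0) (nhds u0)"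
      by (rule tendsto_imp_eventually_ne) (simp add: \<psi>u0)
    then show ?thesis using that unfolding eventually_nhds by blast
  qed
  have \<zeta>: "(\<zeta> (\<lambda>_ v. v) has_derivative frechet_derivative (\<zeta> (\<lambda>_ v. v)) (at u0)) (at u0)"
    unfolding \<zeta>_def u0_def q_def by (rule field_has_derivative[OF A B Z])
  have \<zeta>u0: "\<zeta> (\<lambda>_ v. v) u0 = Z p"
    using coord_self[OF A, of q] by (simp add: \<zeta>_def pu0 q_def)
  have "\<exists>a'. (a b has_derivative a') (at u0)" for b
    using has_derivative_divide[OF has_derivative_inner_left[OF \<zeta>] \<psi>] \<psi>u0
    by (auto simp: a_def[abs_def])
  then obtain a' where a': "\<And>b. (a b has_derivative a' b) (at u0)" by metis
  have au0: "a b u0 = Z p \<bullet> b" for b by (simp add: a_def \<zeta>u0 \<psi>u0)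
  \<comment> \<open>This is the product rule for \<open>G\<close> applied to the expansion of
    \<open>Z\<close>. The derivatives \<open>a'\<close> of the coefficients do not depend on
    \<open>G\<close>, so the formulas for the identity and for \<open>P\<close> can be compared term
    by term.\<close>
  have deriv: "frechet_derivative (\<zeta> G) (at u0) w =
      (\<Sum>b\<in>Basis. (Z p \<bullet> b) *\<^sub>R D\<eta> G b (differential B A F p w) + a' b w *\<^sub>R G q b)"
    if G: "\<And>x. linear (G x)" "\<And>b. (\<lambda>x. G x (E b x)) \<in> vector_fields A" for G w
  proof -
    have \<eta>: "(\<eta> G b has_derivative D\<eta> G b) (at (\<Phi> u0))" for b
      using field_has_derivative[OF A A, of id "\<lambda>x. G x (E b x)" q] G(2)[of b]
      unfolding vector_fields_def D\<eta>_def \<eta>_def \<Phi>u0 by simp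
    have \<eta>u0: "\<eta> G b (\<Phi> u0) = G q b" for b
      using coord_self[OF A, of q] by (simp add: \<eta>_def \<Phi>u0 A chart_point[OF A] Eq)
    have "((\<lambda>u. \<Sum>b\<in>Basis. a b u *\<^sub>R \<eta> G b (\<Phi> u)) has_derivative
        (\<lambda>w. \<Sum>b\<in>Basis. a b u0 *\<^sub>R D\<eta> G b (differential B A F p w) + a' b w *\<^sub>R \<eta> G b (\<Phi> u0))) (at u0)"
      by (intro has_derivative_sum has_derivative_scaleR a' has_derivative_compose[OF \<Phi> \<eta>])
    then have "(\<zeta> G has_derivative
        (\<lambda>w. \<Sum>b\<in>Basis. a b u0 *\<^sub>R D\<eta> G b (differential B A F p w) + a' b w *\<^sub>R \<eta> G b (\<Phi> u0))) (at u0)"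
    proof (rule has_derivative_transform_within_open)
      show "open (S \<inter> T)" "u0 \<in> S \<inter> T" using S T u0S by auto
      fix u assume u: "u \<in> S \<inter> T"
      then obtain s where s: "u = cmap B p s" "s \<in> cdom B p" "F s \<in> cdom A q"
        by (auto simp: S_def)
      have lin: "linear (coord A q (F s))" by (rule linear_coord[OF A s(3)])
      have us: "cinv B p u = s" "cinv A q (\<Phi> u) = F s" using s by (auto simp: \<Phi>_def A B)
      have \<phi>s: "\<phi> (F s) \<noteq> 0" using u T(3)[of u] us by (simp add: \<psi>_def)
      \<comment> \<open>Both sides of the expansion of \<open>Z\<close> have the same components in
        \<open>A q\<close>; injectivity of \<open>coord\<close> then gives the expansion
        itself.\<close>
      have "coord A q (F s) (\<Sum>b\<in>Basis. a b u *\<^sub>R E b (F s))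
          = (\<Sum>b\<in>Basis. (coord A q (F s) (Z s) \<bullet> b) *\<^sub>R b)"
        using \<phi>s by (simp add: linear_sum[OF lin] linear_cmul[OF lin] coordE[OF s(3)] a_def \<zeta>_def \<psi>_def us)
      then have "(\<Sum>b\<in>Basis. a b u *\<^sub>R E b (F s)) = Z s"
        unfolding euclidean_representation by (rule injD[OF inj_coord[OF A s(3)]])
      then have "\<zeta> G u = coord A q (F s) (G (F s) (\<Sum>b\<in>Basis. a b u *\<^sub>R E b (F s)))"
        by (simp add: \<zeta>_def us)
      then show "(\<Sum>b\<in>Basis. a b u *\<^sub>R \<eta> G b (\<Phi> u)) = \<zeta> G u"
        by (simp add: linear_sum[OF lin] linear_cmul[OF lin] linear_sum[OF G(1)] linear_cmul[OF G(1)]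
            \<eta>_def us)
    qed
    then show ?thesis by (simp add: frechet_derivative_eqI au0 \<eta>u0)
  qed
  \<comment> \<open>\<open>nabla\<close> differentiates in the direction of the preimage of
    \<open>X p\<close>; its push-forward \<open>X p\<close> is the direction in which the ambient
    fields are differentiated.\<close>
  define w where "w = inv (differential B A F p) (X p)"
  have w: "differential B A F p w = X p" unfolding w_def by (rule f_inv_into_f[OF X])
  \<comment> \<open>At \<open>q\<close> the covariant derivative depends on its first field only
    through the value there, so the global field \<open>E (X p)\<close>, whose value at
    \<open>q\<close> is \<open>X p\<close>, can serve as direction.\<close>
  have parE: "D\<eta> P b (X p) + C q (X p) (P q b) = P q (D\<eta> (\<lambda>_ v. v) b (X p) + C q (X p) b)" for b
    using par[OF E[of "X p"] E[of b], of q] by (simp add: nabla_id[OF A] Eq D\<eta>_def \<eta>_def[abs_def])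
  have CZ: "C q (X p) (L (Z p)) = (\<Sum>b\<in>Basis. (Z p \<bullet> b) *\<^sub>R C q (X p) (L b))" if "linear L" for L
    using linear_euclidean_sum[OF linear_compose[OF that, of "C q (X p)"], of "Z p"] C[of q]
    by (simp add: bilinear_def)
  note derivP = deriv[OF P PV[OF E], of w, unfolded w]
  note deriv_id = deriv[of "\<lambda>_ v. v", OF linear_ident E, of w, unfolded w]
  have "nabla A C B F X (\<lambda>x. P (F x) (Z x)) p = frechet_derivative (\<zeta> P) (at u0) w + C q (X p) (P q (Z p))"
    by (simp add: nabla_def \<zeta>_def[abs_def] u0_def w_def q_def)
  also have "\<dots> = (\<Sum>b\<in>Basis. (Z p \<bullet> b) *\<^sub>R (D\<eta> P b (X p) + C q (X p) (P q b)) + a' b w *\<^sub>R P q b)"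
    by (simp only: derivP CZ[OF P] sum.distrib scaleR_add_right add.assoc) (simp only: ac_simps)
  also have "\<dots> = P q ((\<Sum>b\<in>Basis. (Z p \<bullet> b) *\<^sub>R (D\<eta> (\<lambda>_ v. v) b (X p) + C q (X p) b) + a' b w *\<^sub>R b))"
    by (simp only: parE linear_sum[OF P] linear_add[OF P] linear_cmul[OF P])
  also have "(\<Sum>b\<in>Basis. (Z p \<bullet> b) *\<^sub>R (D\<eta> (\<lambda>_ v. v) b (X p) + C q (X p) b) + a' b w *\<^sub>R b)
      = frechet_derivative (\<zeta> (\<lambda>_ v. v)) (at u0) w + C q (X p) (Z p)"
    by (simp only: deriv_id CZ[OF linear_ident] sum.distrib scaleR_add_right add.assoc)
       (simp only: ac_simps)
  also have "\<dots> = nabla A C B F X Z p"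
    by (simp add: nabla_def \<zeta>_def[abs_def] u0_def w_def q_def)
  finally show ?thesis by (simp add: q_def)
qed

section \<open>Linear algebra of a scalar product\<close>

text \<open>Coefficients are indexed by \<open>I\<close> rather than by vectors, so the family may
  have repetitions and the same coefficients can be used at other points of a frame.\<close>

lemma in_span_image_imp_sum:
  fixes e :: "'i \<Rightarrow> 'a::real_vector"
  assumes "finite I" "v \<in> span (e ` I)"
  obtains c where "v = (\<Sum>i\<in>I. c i *\<^sub>R e i)"
proof -
  from assms(2) have "\<exists>c. v = (\<Sum>i\<in>I. c i *\<^sub>R e i)"
  proof (induction rule: span_induct_alt)
    case base
    show ?case by (rule exI[of _ "\<lambda>_. 0"]) simp
  next
    case (step k x y)
    then obtain j c where j: "j \<in> I" "x = e j" "y = (\<Sum>i\<in>I. c i *\<^sub>R e i)" by auto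
    have "(\<Sum>i\<in>I. (if i = j then k else 0) *\<^sub>R e i) = (\<Sum>i\<in>I. if i = j then k *\<^sub>R e i else 0)"
      by (rule sum.cong) auto
    then have "k *\<^sub>R x + y = (\<Sum>i\<in>I. ((if i = j then k else 0) + c i) *\<^sub>R e i)"
      using j assms(1) by (simp add: scaleR_add_left sum.distrib)
    then show ?case by (rule exI[of _ "\<lambda>i. (if i = j then k else 0) + c i"])
  qed
  then show ?thesis using that by blast
qed

text \<open>The form is represented through the Euclidean inner product by a linear map
  \<open>f\<close>. Nondegeneracy makes \<open>f\<close> bijective, and it carries the complement
  for \<open>b\<close> onto the Euclidean orthogonal complement.\<close>

lemma dim_nondegenerate_perp:
  fixes b :: "'e::euclidean_space \<Rightarrow> 'e \<Rightarrow> real"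
  assumes bil: "bilinear b" and nondeg: "\<And>u. (\<And>v. b u v = 0) \<Longrightarrow> u = 0" and "subspace W"
  shows "dim {v. \<forall>u\<in>W. b v u = 0} + dim W = DIM('e)"
proof -
  define f where "f v = (\<Sum>i\<in>Basis. b v i *\<^sub>R i)" for v
  have f: "f v \<bullet> u = b v u" for u v
  proof -
    have "f v \<bullet> u = (\<Sum>i\<in>Basis. (u \<bullet> i) *\<^sub>R b v i)"
      by (simp add: f_def inner_sum_left mult.commute inner_commute[of u])
    also have "\<dots> = b v u"
      using linear_euclidean_sum[of "b v" u] bil by (simp add: bilinear_def)
    finally show ?thesis .
  qed
  have lin: "linear f"
    by (rule linearI)
       (simp_all add: f_def bilinear_ladd[OF bil] bilinear_lmul[OF bil] scaleR_add_left
         sum.distrib scaleR_sum_right)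
  have "inj f"
    unfolding linear_injective_0[OF lin] using nondeg f by (metis inner_zero_left)
  have "surj f"
    by (rule linear_injective_imp_surjective[OF lin \<open>inj f\<close>]) simp
  define U where "U = {y \<in> UNIV. \<forall>x\<in>W. orthogonal x y}"
  have "{v. \<forall>u\<in>W. b v u = 0} = f -` U"
    by (auto simp: U_def orthogonal_def f inner_commute[of _ "f _"])
  moreover have "dim (f -` U) = dim U"
    using dim_image_eq[OF lin, of "f -` U"] \<open>inj f\<close> \<open>surj f\<close>
    by (simp add: surj_image_vimage_eq inj_on_subset)
  moreover have "dim U + dim W = DIM('e)"
    using dim_subspace_orthogonal_to_vectors[OF assms(3) subspace_UNIV] by (simp add: U_def)
  ultimately show ?thesis by simp
qed

text \<open>Pairing with \<open>\<xi> j\<close> reads off the coefficient of \<open>N j\<close>. It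
  is applied in both directions between Rad TM and ltr(TM).\<close>

lemma dual_families_nondegenerate:
  fixes b :: "'e::real_vector \<Rightarrow> 'e \<Rightarrow> real"
  assumes bil: "\<And>v. linear (\<lambda>u. b u v)" and "finite I"
    and dual: "\<And>i j. i \<in> I \<Longrightarrow> j \<in> I \<Longrightarrow> b (N i) (\<xi> j) = (if i = j then 1 else 0)"
    and n: "n \<in> span (N ` I)" "\<And>j. j \<in> I \<Longrightarrow> b n (\<xi> j) = 0"
  shows "n = 0"
proof -
  obtain c where c: "n = (\<Sum>i\<in>I. c i *\<^sub>R N i)"
    using in_span_image_imp_sum[OF \<open>finite I\<close> n(1)] .
  have "c j = 0" if "j \<in> I" for j
  proof -
    have "b n (\<xi> j) = (\<Sum>i\<in>I. c i * b (N i) (\<xi> j))"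
      by (simp add: c linear_sum[OF bil] linear_cmul[OF bil])
    also have "\<dots> = (\<Sum>i\<in>I. if i = j then c i else 0)"
      using dual that by (intro sum.cong) auto
    finally show ?thesis using n(2) that \<open>finite I\<close> by simp
  qed
  then show ?thesis by (simp add: c)
qed

lemma perp_span:
  fixes b :: "'e::real_vector \<Rightarrow> 'e \<Rightarrow> real"
  assumes "\<And>v. linear (\<lambda>u. b u v)" "\<And>e. e \<in> E \<Longrightarrow> b e v = 0" "n \<in> span E"
  shows "b n v = 0"
  using assms(3)
proof (induction rule: span_induct_alt)
  case base
  show ?case using linear_0[OF assms(1)] .
qed (simp add: linear_add[OF assms(1)] linear_cmul[OF assms(1)] assms(2))

text \<open>Two candidates for the definite description differ by an element of both
  \<open>E\<close> and \<open>E'\<close>.\<close>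

lemma part_eqI:
  fixes E E' :: "'e::real_vector set"
  assumes "subspace E" "subspace E'" "E \<inter> E' = {0}" "a \<in> E" "v - a \<in> E'"
  shows "part E E' v = a"
  unfolding part_def
proof (rule the_equality)
  fix a' assume a': "a' \<in> E \<and> v - a' \<in> E'"
  then have "a' - a \<in> E \<inter> E'"
    using subspace_diff[OF assms(1), of a' a] subspace_diff[OF assms(2), of "v - a" "v - a'"]
      assms(4,5) by (intro IntI) simp_all
  then have "a' - a = 0" using assms(3) by blast
  then show "a' = a" by simp
qed (use assms in simp)

lemma
  fixes E E' :: "'e::real_vector set"
  assumes "subspace E" "subspace E'" "E \<inter> E' = {0}" "v \<in> E + E'"
  shows part_in: "part E E' v \<in> E"
    and part_diff_in: "v - part E E' v \<in> E'"
    and part_add_part: "part E E' v + part E' E v = v"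
proof -
  obtain a a' where a: "a \<in> E" "a' \<in> E'" "v = a + a'" using assms(4) by (rule set_plus_elim)
  have 1: "part E E' v = a" by (rule part_eqI) (use assms a in auto)
  have "part E' E v = a'" by (rule part_eqI) (use assms a in auto)
  with 1 a show "part E E' v \<in> E" "v - part E E' v \<in> E'" "part E E' v + part E' E v = v" by auto
qed

lemma set_plus_eq_sums: "E + E' = {x + y |x y. x \<in> E \<and> y \<in> E'}"
  by (auto simp: set_plus_def)

lemma subspace_set_plus: "subspace E \<Longrightarrow> subspace E' \<Longrightarrow> subspace (E + E')"
  unfolding set_plus_eq_sums by (rule subspace_sums)

lemma dim_set_plus:
  fixes E E' :: "'e::euclidean_space set"
  assumes "subspace E" "subspace E'" "E \<inter> E' = {0}"
  shows "dim (E + E') = dim E + dim E'"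
  using dim_sums_Int[OF assms(1,2)] assms(3) by (simp add: set_plus_eq_sums)

section \<open>Lightlike submanifolds\<close>

lemma subbundle_subspace: "subbundle A M k E \<Longrightarrow> subspace (E p)"
  unfolding subbundle_def by (metis subspace_span)

lemma subbundle_dim: "subbundle A M k E \<Longrightarrow> dim (E p) = k"
  unfolding subbundle_def by blast

text \<open>The vector is continued with constant coefficients in a local frame and cut off. This
  passes from conditions on global sections to conditions on single vectors.\<close>

lemma section_through:
  fixes A :: "('m::{t2_space, second_countable_topology}, 'e::euclidean_space) ambient"
    and M :: "('s::{t2_space, second_countable_topology}, 'd::euclidean_space, 'm, 'e) submfd"
  assumes A: "smooth_manifold (atl A)" and B: "smooth_manifold (satl M)"
    and F: "continuous_on UNIV (imm M)" and E: "subbundle A M k E" and v: "v \<in> E p"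
  obtains Y where "Y \<in> sections A M E" "Y p = v"
proof -
  obtain V e where V: "open V" "p \<in> V" and e: "\<And>i. i < k \<Longrightarrow> smooth_along A M V (e i)"
    and span: "\<And>x. x \<in> V \<Longrightarrow> span ((\<lambda>i. e i x) ` {..<k}) = E x"
    using E unfolding subbundle_def by metis
  obtain c where c: "v = (\<Sum>i<k. c i *\<^sub>R e i p)"
    using in_span_image_imp_sum[of "{..<k}" v "\<lambda>i. e i p"] span[OF V(2)] v by auto
  obtain \<phi> K where \<phi>: "smooth_fun (satl M) \<phi>" "\<phi> p = 1" "closed K" "K \<subseteq> V" "\<And>x. x \<notin> K \<Longrightarrow> \<phi> x = 0"
    using smooth_cutoff[OF B V] by metis
  let ?Y = "\<lambda>x. \<phi> x *\<^sub>R (\<Sum>i<k. c i *\<^sub>R e i x)"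
  have "smooth_along A M UNIV ?Y"
    unfolding smooth_along_def
    by (rule smooth_field_cutoff[OF A B F V(1) smooth_field_on_sum[OF A B F V(1)] \<phi>(1,3-5)])
       (use e in \<open>auto simp: smooth_along_def\<close>)
  moreover have "?Y x \<in> E x" for x
  proof (cases "x \<in> V")
    case True
    have "(\<Sum>i<k. c i *\<^sub>R e i x) \<in> span ((\<lambda>i. e i x) ` {..<k})"
      by (intro span_sum span_scale span_base) auto
    then show ?thesis using span[OF True] span_scale by metis
  next
    case False
    then have "?Y x = 0" using \<phi>(4,5) by auto
    then show ?thesis by (metis subspace_0 subbundle_subspace[OF E])
  qed
  ultimately have "?Y \<in> sections A M E" by (simp add: sections_def)
  moreover have "?Y p = v" by (simp add: c \<phi>(2))
  ultimately show ?thesis by (rule that)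
qed

section \<open>Bronze structure and connection along the submanifold\<close>

context
  fixes A :: "('m::{t2_space, second_countable_topology}, 'e::euclidean_space) ambient"
    and M :: "('s::{t2_space, second_countable_topology}, 'd::euclidean_space, 'm, 'e) submfd"
  assumes lb: "locally_bronze_manifold A" and ll: "lightlike_submanifold A M"
begin

lemma atl_manifold: "smooth_manifold (atl A)"
  using lb by (simp add: locally_bronze_manifold_def bronze_manifold_def)

lemma satl_manifold: "smooth_manifold (satl M)"
  using ll by (simp add: lightlike_submanifold_def)

lemma imm_smooth: "smooth_map (satl M) (atl A) (imm M)"
  using ll by (simp add: lightlike_submanifold_def injective_immersion_def)

lemma imm_continuous: "continuous_on UNIV (imm M)"
  using imm_smooth by (simp add: smooth_map_def)

lemma inj_differential: "inj (differential (satl M) (atl A) (imm M) p)"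
  using ll by (simp add: lightlike_submanifold_def injective_immersion_def)

lemma conn_bilinear: "bilinear (conn A q)"
  using lb by (simp add: locally_bronze_manifold_def levi_civita_def affine_connection_def)

lemma brz_linear: "linear (brz A q)"
  using lb by (simp add: locally_bronze_manifold_def bronze_manifold_def)

lemma J_linear: "linear (J A M p)"
  using brz_linear by (simp add: J_def[abs_def])

lemma J_J: "J A M p (J A M p v) = 3 *\<^sub>R J A M p v + v"
  using lb by (simp add: locally_bronze_manifold_def bronze_manifold_def J_def)

lemma ip_bilinear: "bilinear (ip A M p)"
  and ip_commute: "ip A M p u v = ip A M p v u"
  and ip_nondegenerate: "(\<And>v. ip A M p u v = 0) \<Longrightarrow> u = 0"
proof -
  have *: "bilinear (met A q) \<and> (\<forall>u v. met A q u v = met A q v u) \<and>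
      (\<forall>u. (\<forall>v. met A q u v = 0) \<longrightarrow> u = 0)" for q
    using lb unfolding locally_bronze_manifold_def bronze_manifold_def semi_riemannian_def by blast
  have eta: "ip A M p = met A (imm M p)" by (rule ext)+ (simp add: ip_def)
  show "bilinear (ip A M p)" "ip A M p u v = ip A M p v u"
    "(\<And>v. ip A M p u v = 0) \<Longrightarrow> u = 0"
    using * unfolding eta by blast+
qed

lemma ip_linear_left: "linear (\<lambda>u. ip A M p u v)" and ip_linear_right: "linear (ip A M p v)"
  using ip_bilinear by (auto simp: bilinear_def)

lemmas ip_simps = bilinear_ladd[OF ip_bilinear] bilinear_radd[OF ip_bilinear]
  bilinear_lmul[OF ip_bilinear] bilinear_rmul[OF ip_bilinear]
  bilinear_lsub[OF ip_bilinear] bilinear_rsub[OF ip_bilinear]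
  bilinear_lneg[OF ip_bilinear] bilinear_rneg[OF ip_bilinear]

lemma ip_J: "ip A M p (J A M p u) v = ip A M p u (J A M p v)"
  using lb by (simp add: locally_bronze_manifold_def bronze_manifold_def ip_def J_def)

text \<open>The Levi-Civita part commutes with J by \<open>nabla_parallel_endomorphism\<close>. What
  remains is the (l,m)-term of JZ minus the image under J of the (l,m)-term of Z.\<close>

lemma Omega_bar_J:
  assumes X: "X p \<in> TM A M p" and Z: "smooth_along A M UNIV Z"
  shows "Omega_bar A M X (\<lambda>x. J A M x (Z x)) p = J A M p (Omega_bar A M X Z p)
    + ip A M p (J A M p (Z p)) (eta A (imm M p)) *\<^sub>R
        (lfn A (imm M p) *\<^sub>R X p + mfn A (imm M p) *\<^sub>R J A M p (X p))
    - ip A M p (Z p) (eta A (imm M p)) *\<^sub>R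
        (lfn A (imm M p) *\<^sub>R J A M p (X p) + mfn A (imm M p) *\<^sub>R J A M p (J A M p (X p)))"
proof -
  have "nabla (atl A) (conn A) (satl M) (imm M) X (\<lambda>x. brz A (imm M x) (Z x)) p =
      brz A (imm M p) (nabla (atl A) (conn A) (satl M) (imm M) X Z p)"
  proof (rule nabla_parallel_endomorphism[OF atl_manifold satl_manifold imm_smooth
        conn_bilinear brz_linear _ _ inj_differential])
    show "X p \<in> range (differential (satl M) (atl A) (imm M) p)" using X by (simp add: TM_def)
    show "smooth_field_on (satl M) (atl A) (imm M) UNIV Z" using Z by (simp add: smooth_along_def)
  qed (use lb in \<open>auto simp: locally_bronze_manifold_def bronze_manifold_def\<close>)
  then have "nabla (atl A) (conn A) (satl M) (imm M) X (\<lambda>x. J A M x (Z x)) p =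
      J A M p (nabla (atl A) (conn A) (satl M) (imm M) X Z p)"
    by (simp add: J_def)
  then show ?thesis
    by (simp add: Omega_bar_def linear_add[OF J_linear] linear_cmul[OF J_linear])
qed

lemma Omega_bar_add:
  assumes "smooth_along A M UNIV Y" "smooth_along A M UNIV Z"
  shows "Omega_bar A M X (\<lambda>x. Y x + Z x) p = Omega_bar A M X Y p + Omega_bar A M X Z p"
  using nabla_add[OF atl_manifold satl_manifold imm_continuous conn_bilinear] assms
  by (simp add: Omega_bar_def smooth_along_def ip_simps scaleR_add_left)

section \<open>Decomposition of the ambient tangent spaces along the submanifold\<close>

lemma TM_subspace: "subspace (TM A M p)"
  unfolding TM_def
  by (intro linear_subspace_image subspace_UNIV has_derivative_linear[OF
        differential_has_derivative[OF atl_manifold satl_manifold imm_smooth]])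

lemma TMperp_subspace: "subspace (TMperp A M p)"
  by (rule subspaceI) (auto simp: TMperp_def ip_simps linear_0[OF ip_linear_left])

lemma Rad_subspace: "subspace (Rad A M p)"
  unfolding Rad_def by (intro subspace_inter TM_subspace TMperp_subspace)

lemma scr_subspace: "subspace (scr M p)" and scrt_subspace: "subspace (scrt M p)"
  and ltr_subspace: "subspace (ltr M p)"
proof -
  have "(\<exists>k. subbundle A M k (scr M)) \<and> (\<exists>k. subbundle A M k (scrt M)) \<and> (\<exists>k. subbundle A M k (ltr M))"
    using ll unfolding lightlike_submanifold_def by blast
  then show "subspace (scr M p)" "subspace (scrt M p)" "subspace (ltr M p)"
    using subbundle_subspace by blast+
qed

lemma Rad_Int_scr: "Rad A M p \<inter> scr M p = {0}" and Rad_plus_scr: "Rad A M p + scr M p = TM A M p"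
  and Rad_Int_scrt: "Rad A M p \<inter> scrt M p = {0}"
  and Rad_plus_scrt: "Rad A M p + scrt M p = TMperp A M p"
  using ll by (auto simp: lightlike_submanifold_def)

lemma scr_subset_TM: "scr M p \<subseteq> TM A M p"
  unfolding Rad_plus_scr[symmetric]
  using set_zero_plus2[OF subspace_0[OF Rad_subspace]] .

lemma scrt_subset_TMperp: "scrt M p \<subseteq> TMperp A M p"
  unfolding Rad_plus_scrt[symmetric]
  using set_zero_plus2[OF subspace_0[OF Rad_subspace]] .

text \<open>Only the values at \<open>p\<close> of the local frames are kept, since the
  decomposition is linear algebra in a single fibre.\<close>

lemma ltr_frames:
  obtains \<xi> N :: "nat \<Rightarrow> 'e" and r :: nat where
    "span (\<xi> ` {..<r}) = Rad A M p" "span (N ` {..<r}) = ltr M p"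
    "dim (Rad A M p) = r" "dim (ltr M p) = r"
    "\<And>i v. i < r \<Longrightarrow> v \<in> scr M p \<Longrightarrow> ip A M p (N i) v = 0"
    "\<And>i v. i < r \<Longrightarrow> v \<in> scrt M p \<Longrightarrow> ip A M p (N i) v = 0"
    "\<And>i j. i < r \<Longrightarrow> j < r \<Longrightarrow> ip A M p (N i) (\<xi> j) = (if i = j then 1 else 0)"
    "\<And>i j. i < r \<Longrightarrow> j < r \<Longrightarrow> ip A M p (N i) (N j) = 0"
proof -
  define frame where "frame r x \<xi> N \<longleftrightarrow>
        span ((\<lambda>i. \<xi> i x) ` {..<r}) = Rad A M x \<and> span ((\<lambda>i. N i x) ` {..<r}) = ltr M x \<and>
        (\<forall>i<r. (\<forall>v\<in>scr M x. ip A M x (N i x) v = 0) \<and> (\<forall>v\<in>scrt M x. ip A M x (N i x) v = 0) \<and>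
          (\<forall>j<r. ip A M x (N i x) (\<xi> j x) = (if i = j then 1 else 0) \<and> ip A M x (N i x) (N j x) = 0))"
    for r x and \<xi> N :: "nat \<Rightarrow> 's \<Rightarrow> 'e"
  have "\<exists>r>0. subbundle A M r (Rad A M) \<and> subbundle A M r (ltr M) \<and>
      (\<forall>p. \<exists>V. open V \<and> p \<in> V \<and> (\<exists>\<xi> N.
        (\<forall>i<r. smooth_along A M V (\<xi> i) \<and> smooth_along A M V (N i)) \<and> (\<forall>x\<in>V. frame r x \<xi> N)))"
    using ll unfolding lightlike_submanifold_def frame_def by (elim conjE)
  then obtain r \<xi> N where sub: "subbundle A M r (Rad A M)" "subbundle A M r (ltr M)"
    and f: "frame r p \<xi> N" by meson
  show ?thesis
    by (rule that[of "\<lambda>i. \<xi> i p" r "\<lambda>i. N i p"])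
       (use f[unfolded frame_def] sub[THEN subbundle_dim] in \<open>simp_all\<close>)
qed

text \<open>The orthogonality relations hold on the frame of ltr(TM) and pass to its span; duality
  of the two frames makes the pairing of Rad TM with ltr(TM) nondegenerate on both sides.\<close>

lemma ltr_perp_scr: "n \<in> ltr M p \<Longrightarrow> v \<in> scr M p \<Longrightarrow> ip A M p n v = 0"
  and ltr_perp_scrt: "n \<in> ltr M p \<Longrightarrow> v \<in> scrt M p \<Longrightarrow> ip A M p n v = 0"
  and ltr_isotropic: "n \<in> ltr M p \<Longrightarrow> n' \<in> ltr M p \<Longrightarrow> ip A M p n n' = 0"
  and ltr_Rad_nondegenerate: "n \<in> ltr M p \<Longrightarrow> (\<And>\<rho>. \<rho> \<in> Rad A M p \<Longrightarrow> ip A M p n \<rho> = 0) \<Longrightarrow> n = 0"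
  and Rad_ltr_nondegenerate: "\<rho> \<in> Rad A M p \<Longrightarrow> (\<And>n. n \<in> ltr M p \<Longrightarrow> ip A M p n \<rho> = 0) \<Longrightarrow> \<rho> = 0"
  and dim_Rad_ltr: "dim (Rad A M p) = dim (ltr M p)"
proof -
  obtain \<xi> N r where f: "span (\<xi> ` {..<r}) = Rad A M p" "span (N ` {..<r}) = ltr M p"
    "dim (Rad A M p) = r" "dim (ltr M p) = r"
    "\<And>i v. i < r \<Longrightarrow> v \<in> scr M p \<Longrightarrow> ip A M p (N i) v = 0"
    "\<And>i v. i < r \<Longrightarrow> v \<in> scrt M p \<Longrightarrow> ip A M p (N i) v = 0"
    "\<And>i j. i < r \<Longrightarrow> j < r \<Longrightarrow> ip A M p (N i) (\<xi> j) = (if i = j then 1 else 0)"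
    "\<And>i j. i < r \<Longrightarrow> j < r \<Longrightarrow> ip A M p (N i) (N j) = 0"
    by (rule ltr_frames[of p]) (rule that)
  have perp: "ip A M p n v = 0" if "n \<in> ltr M p" "\<And>i. i < r \<Longrightarrow> ip A M p (N i) v = 0" for n v
  proof (rule perp_span[OF ip_linear_left])
    show "n \<in> span (N ` {..<r})" using that(1) f(2) by simp
  qed (use that(2) in auto)
  show "n \<in> ltr M p \<Longrightarrow> v \<in> scr M p \<Longrightarrow> ip A M p n v = 0"
    "n \<in> ltr M p \<Longrightarrow> v \<in> scrt M p \<Longrightarrow> ip A M p n v = 0"
    using perp f(5,6) by blast+
  show "ip A M p n n' = 0" if "n \<in> ltr M p" "n' \<in> ltr M p"
  proof (rule perp[OF that(1)])
    fix i assume i: "i < r"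
    have "ip A M p n' (N i) = 0" by (rule perp[OF that(2)]) (use f(8) i in auto)
    then show "ip A M p (N i) n' = 0" by (simp add: ip_commute)
  qed
  have \<xi>: "\<xi> i \<in> Rad A M p" if "i < r" for i using that f(1) by (auto intro: span_base)
  have N: "N i \<in> ltr M p" if "i < r" for i using that f(2) by (auto intro: span_base)
  show "n = 0" if "n \<in> ltr M p" "\<And>\<rho>. \<rho> \<in> Rad A M p \<Longrightarrow> ip A M p n \<rho> = 0"
    by (rule dual_families_nondegenerate[where b="ip A M p" and N=N and \<xi>=\<xi>,
          OF ip_linear_left finite_lessThan[of r]])
       (use that(1) in \<open>simp_all add: f(2,7) that(2)[OF \<xi>]\<close>)
  show "\<rho> = 0" if "\<rho> \<in> Rad A M p" "\<And>n. n \<in> ltr M p \<Longrightarrow> ip A M p n \<rho> = 0"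
    by (rule dual_families_nondegenerate[where b="\<lambda>u v. ip A M p v u" and N=\<xi> and \<xi>=N,
          OF ip_linear_right finite_lessThan[of r]])
       (use that(1) in \<open>auto simp: f(1,7) that(2)[OF N]\<close>)
  show "dim (Rad A M p) = dim (ltr M p)" using f by simp
qed

lemma tr_subspace: "subspace (tr M p)"
  unfolding tr_def by (intro subspace_set_plus ltr_subspace scrt_subspace)

lemma ltr_Int_TMperp: "ltr M p \<inter> TMperp A M p = {0}"
  using ltr_Rad_nondegenerate[of _ p] subspace_0[OF ltr_subspace] subspace_0[OF TMperp_subspace]
  by (auto simp: TMperp_def Rad_def)

text \<open>For \<open>v = n + s\<close>, pairing with the radical kills both \<open>v\<close> and
  \<open>s\<close>, so \<open>n = 0\<close> by duality. Then \<open>v = s\<close> lies in the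
  radical and in its complement \<open>scrt\<close>.\<close>

lemma TM_Int_tr: "TM A M p \<inter> tr M p = {0}"
proof -
  have "v = 0" if v: "v \<in> TM A M p" "v \<in> tr M p" for v
  proof -
    obtain n s where ns: "v = n + s" "n \<in> ltr M p" "s \<in> scrt M p"
      using v(2) unfolding tr_def by (rule set_plus_elim)
    have s: "s \<in> TMperp A M p" using ns(3) scrt_subset_TMperp by blast
    have "n = 0"
    proof (rule ltr_Rad_nondegenerate[OF ns(2)])
      fix \<rho> assume \<rho>: "\<rho> \<in> Rad A M p"
      have "ip A M p \<rho> v = 0" "ip A M p s \<rho> = 0"
        using \<rho> v(1) s by (auto simp: Rad_def TMperp_def)
      then show "ip A M p n \<rho> = 0" by (simp add: ns(1) ip_simps ip_commute)
    qed
    then have "v \<in> Rad A M p \<inter> scrt M p" using ns v(1) s by (simp add: Rad_def)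
    then show "v = 0" using Rad_Int_scrt by blast
  qed
  then show ?thesis using subspace_0[OF TM_subspace] subspace_0[OF tr_subspace] by blast
qed

text \<open>A dimension count: ltr(TM) has the rank of the radical, so \<open>tr\<close> has the
  dimension of \<open>TMperp\<close>, which is complementary to that of \<open>TM\<close>.\<close>

lemma TM_plus_tr: "TM A M p + tr M p = UNIV"
proof -
  have "ltr M p \<inter> scrt M p = {0}"
    using ltr_Int_TMperp scrt_subset_TMperp subspace_0[OF ltr_subspace] subspace_0[OF scrt_subspace]
    by blast
  then have "dim (tr M p) = dim (ltr M p) + dim (scrt M p)"
    unfolding tr_def by (intro dim_set_plus ltr_subspace scrt_subspace)
  moreover have "dim (TMperp A M p) = dim (Rad A M p) + dim (scrt M p)"
    unfolding Rad_plus_scrt[symmetric] by (intro dim_set_plus Rad_subspace scrt_subspace Rad_Int_scrt)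
  moreover have "dim (TMperp A M p) + dim (TM A M p) = DIM('e)"
    unfolding TMperp_def by (rule dim_nondegenerate_perp[OF ip_bilinear ip_nondegenerate TM_subspace])
  ultimately have "dim (TM A M p + tr M p) = DIM('e)"
    using dim_set_plus[OF TM_subspace tr_subspace TM_Int_tr, of p] dim_Rad_ltr[of p] by simp
  then show ?thesis
    using subspace_set_plus[OF TM_subspace tr_subspace, of p] by (metis dim_eq_full span_eq_iff)
qed

section \<open>Tangential components and their pairings\<close>

lemma part_TM_in: "part (TM A M p) (tr M p) v \<in> TM A M p"
  by (rule part_in) (simp_all add: TM_subspace tr_subspace TM_Int_tr TM_plus_tr)

lemma part_TM_diff_in: "v - part (TM A M p) (tr M p) v \<in> tr M p"
  by (rule part_diff_in) (simp_all add: TM_subspace tr_subspace TM_Int_tr TM_plus_tr)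

lemma part_TM_tr_add: "part (TM A M p) (tr M p) v + part (tr M p) (TM A M p) v = v"
  by (rule part_add_part) (simp_all add: TM_subspace tr_subspace TM_Int_tr TM_plus_tr)

lemma tr_perp_scr: "t \<in> tr M p \<Longrightarrow> v \<in> scr M p \<Longrightarrow> ip A M p t v = 0"
  unfolding tr_def using ltr_perp_scr scrt_subset_TMperp scr_subset_TM
  by (elim set_plus_elim) (fastforce simp: ip_simps TMperp_def)

lemma tr_perp_ltr: "t \<in> tr M p \<Longrightarrow> n \<in> ltr M p \<Longrightarrow> ip A M p t n = 0"
  unfolding tr_def using ltr_isotropic ltr_perp_scrt ip_commute
  by (elim set_plus_elim) (fastforce simp: ip_simps)

text \<open>\<open>tr\<close> is orthogonal to both \<open>scr\<close> and \<open>ltr\<close>, so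
  pairing with such \<open>u\<close> does not see the transversal component. This is what lets
  \<open>Omega\<close> and \<open>A_bar\<close> be exchanged with the ambient connection.\<close>

lemma ip_part_TM:
  assumes "u \<in> scr M p \<union> ltr M p"
  shows "ip A M p (part (TM A M p) (tr M p) v) u = ip A M p v u"
proof -
  have "ip A M p (v - part (TM A M p) (tr M p) v) u = 0"
    using assms tr_perp_scr[OF part_TM_diff_in] tr_perp_ltr[OF part_TM_diff_in] by blast
  then show ?thesis by (simp add: ip_simps)
qed

text \<open>The component dropped by \<open>h_star\<close> lies in \<open>scr\<close>, orthogonal to
  \<open>ltr\<close>; the one dropped by \<open>Omega_star\<close> lies in the radical, orthogonal
  to \<open>scr\<close>.\<close>

lemma ip_h_star: "n \<in> ltr M p \<Longrightarrow> ip A M p (h_star A M Y Z p) n = ip A M p (Omega A M Y Z p) n"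
  and ip_Omega_star: "x \<in> scr M p \<Longrightarrow> ip A M p (Omega_star A M Y Z p) x = ip A M p (Omega A M Y Z p) x"
proof -
  let ?v = "Omega A M Y Z p"
  have v: "?v \<in> Rad A M p + scr M p" unfolding Rad_plus_scr Omega_def by (rule part_TM_in)
  have "?v - h_star A M Y Z p \<in> scr M p"
    unfolding h_star_def by (rule part_diff_in[OF Rad_subspace scr_subspace Rad_Int_scr v])
  then show "n \<in> ltr M p \<Longrightarrow> ip A M p (h_star A M Y Z p) n = ip A M p ?v n"
    using ltr_perp_scr[of n p] by (fastforce simp: ip_simps ip_commute[of p _ n])
  have "?v - Omega_star A M Y Z p \<in> Rad A M p"
    unfolding Omega_star_def
  proof (rule part_diff_in[OF scr_subspace Rad_subspace])
    show "scr M p \<inter> Rad A M p = {0}" using Rad_Int_scr by blast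
    show "?v \<in> scr M p + Rad A M p" using v by (simp add: add.commute)
  qed
  then show "x \<in> scr M p \<Longrightarrow> ip A M p (Omega_star A M Y Z p) x = ip A M p ?v x"
    using scr_subset_TM[of p] by (fastforce simp: ip_simps Rad_def TMperp_def)
qed

end

section \<open>Parallelism of the complementary distribution\<close>

context
  fixes A :: "('m::{t2_space, second_countable_topology}, 'e::euclidean_space) ambient"
    and M :: "('s::{t2_space, second_countable_topology}, 'd::euclidean_space, 'm, 'e) submfd"
  assumes lb: "locally_bronze_manifold A" and sg: "screen_generic A M"
begin

lemma screen_generic_lightlike: "lightlike_submanifold A M"
  using sg by (simp add: screen_generic_def)

text \<open>From \<open>\<langle>Ju, Jv\<rangle> = 3\<langle>Ju, v\<rangle> + \<langle>u, v\<rangle>\<close>; the \<open>(l,m)\<close>-terms are combinations of \<open>Y\<close> and \<open>JY\<close>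
  and vanish against \<open>u\<close> and \<open>Ju\<close>.\<close>

lemma ip_Omega_bronze:
  assumes Y: "Y \<in> sections A M (B' A M)" and Z: "Z \<in> sections A M (B' A M)"
    and u: "u \<in> scr M p \<union> ltr M p" "J A M p u \<in> scr M p \<union> ltr M p"
    and perp: "ip A M p (Y p) u = 0" "ip A M p (Y p) (J A M p u) = 0"
  shows "ip A M p (Omega A M Y Z p) u =
    (ip A M p (Omega A M Y (fJ A M Z) p) (J A M p u) - ip A M p (A_bar A M (wJ A M Z) Y p) (J A M p u))
    - 3 * (ip A M p (Omega A M Y (fJ A M Z) p) u - ip A M p (A_bar A M (wJ A M Z) Y p) u)"
proof -
  note J_J = J_J[OF lb screen_generic_lightlike] and ip_J = ip_J[OF lb screen_generic_lightlike] and ip_simps = ip_simps[OF lb screen_generic_lightlike]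
  let ?K = "Omega_bar A M Y (\<lambda>x. J A M x (Z x)) p"
  \<comment> \<open>Screen genericity provides smoothness of fZ and wZ, without which the derivative
    of their sum could not be split.\<close>
  have "fJ A M Z \<in> sections A M (B' A M)" "wJ A M Z \<in> sections A M (scrt M)"
    using sg Z by (auto simp: screen_generic_def)
  then have "?K = Omega_bar A M Y (fJ A M Z) p + Omega_bar A M Y (wJ A M Z) p"
    using Omega_bar_add[OF lb screen_generic_lightlike, of "fJ A M Z" "wJ A M Z"] part_TM_tr_add[OF lb screen_generic_lightlike]
    by (simp add: sections_def fJ_def wJ_def)
  then have K: "ip A M p ?K v = ip A M p (Omega A M Y (fJ A M Z) p) v - ip A M p (A_bar A M (wJ A M Z) Y p) v"
    if "v \<in> scr M p \<union> ltr M p" for v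
    using ip_part_TM[OF lb screen_generic_lightlike that] by (simp add: Omega_def A_bar_def ip_simps)
  have "Y p \<in> TM A M p"
    using Y scr_subset_TM[OF lb screen_generic_lightlike] by (auto simp: sections_def B'_def)
  moreover have "smooth_along A M UNIV Z" using Z by (simp add: sections_def)
  ultimately have "ip A M p ?K (J A M p u) - 3 * ip A M p ?K u = ip A M p (Omega_bar A M Y Z p) u"
    using perp by (simp add: Omega_bar_J[OF lb screen_generic_lightlike] ip_simps ip_J J_J)
  then show ?thesis
    using ip_part_TM[OF lb screen_generic_lightlike u(1)] by (simp add: Omega_def[of A M Y Z] K[OF u(1)] K[OF u(2)])
qed

text \<open>If \<open>x = J s\<close> with \<open>s\<close> in the screen, the bronze identity gives
  \<open>J x = 3 x + s\<close>, which is again in the screen.\<close>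

lemma J_Bo: "x \<in> Bo A M p \<Longrightarrow> J A M p x \<in> Bo A M p"
proof -
  assume x: "x \<in> Bo A M p"
  then obtain s where s: "s \<in> scr M p" "x = J A M p s" by (auto simp: Bo_def)
  have x': "x \<in> scr M p" using x by (simp add: Bo_def)
  have "J A M p x = 3 *\<^sub>R x + s" by (simp add: s J_J[OF lb screen_generic_lightlike])
  then have "J A M p x \<in> scr M p"
    using s(1) x' scr_subspace[OF lb screen_generic_lightlike] by (simp add: subspace_add subspace_scale)
  then show ?thesis using x' by (simp add: Bo_def)
qed

text \<open>The screen component is orthogonal to \<open>ltr\<close>, so pairing with
  \<open>ltr\<close> tests exactly whether the radical component vanishes, that is, whether the
  vector lies in the screen. Pairing with \<open>Bo\<close> then tests membership in
  \<open>B'\<close>.\<close>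

lemma Omega_in_B'_iff:
  "Omega A M Y Z p \<in> B' A M p \<longleftrightarrow>
    (\<forall>n\<in>ltr M p. ip A M p (Omega A M Y Z p) n = 0) \<and>
    (\<forall>x\<in>Bo A M p. ip A M p (Omega A M Y Z p) x = 0)"
proof -
  let ?v = "Omega A M Y Z p"
  note ip_simps = ip_simps[OF lb screen_generic_lightlike] and comm = ip_commute[OF lb screen_generic_lightlike]
  have "?v \<in> Rad A M p + scr M p" unfolding Rad_plus_scr[OF lb screen_generic_lightlike] Omega_def by (rule part_TM_in[OF lb screen_generic_lightlike])
  then obtain \<rho> s where v: "?v = \<rho> + s" "\<rho> \<in> Rad A M p" "s \<in> scr M p" by (rule set_plus_elim)
  have "?v \<in> scr M p \<longleftrightarrow> (\<forall>n\<in>ltr M p. ip A M p ?v n = 0)"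
  proof
    assume "\<forall>n\<in>ltr M p. ip A M p ?v n = 0"
    then have "\<rho> = 0"
      using Rad_ltr_nondegenerate[OF lb screen_generic_lightlike v(2)] ltr_perp_scr[OF lb screen_generic_lightlike _ v(3)]
      by (simp add: v(1) ip_simps comm)
    then show "?v \<in> scr M p" using v by simp
  qed (simp add: comm[of p ?v] ltr_perp_scr[OF lb screen_generic_lightlike])
  then show ?thesis by (auto simp: B'_def)
qed

end

text \<open>Condition (i) pairs with JN. The hypothesis \<open>ltr_invariant\<close> puts JN back
  into ltr(TM), where the pairing is insensitive to transversal components; for (ii) the
  corresponding invariance is \<open>J_Bo\<close>.\<close>

theorem theorem5p11:
  fixes A :: "('m::{t2_space, second_countable_topology}, 'e::euclidean_space) ambient"
    and M :: "('s::{t2_space, second_countable_topology}, 'd::euclidean_space, 'm, 'e) submfd"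
  assumes "locally_bronze_manifold A" and "lm_data A" and "screen_generic A M"
    and ltr_invariant: "\<forall>p. J A M p ` ltr M p = ltr M p"
  shows "B'_parallel A M \<longleftrightarrow>
    (\<forall>Y\<in>sections A M (B' A M). \<forall>Z\<in>sections A M (B' A M).
     \<forall>X\<in>sections A M (Bo A M). \<forall>N\<in>sections A M (ltr M).
      (\<forall>p. ip A M p (h_star A M Y (fJ A M Z) p) (J A M p (N p))
             + 3 * ip A M p (A_bar A M (wJ A M Z) Y p) (N p)
           = 3 * ip A M p (h_star A M Y (fJ A M Z) p) (N p)
             + ip A M p (A_bar A M (wJ A M Z) Y p) (J A M p (N p))) \<and>
      (\<forall>p. ip A M p (Omega_star A M Y (fJ A M Z) p) (J A M p (X p))
             + 3 * ip A M p (A_bar A M (wJ A M Z) Y p) (X p)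
           = ip A M p (A_bar A M (wJ A M Z) Y p) (J A M p (X p))
             + 3 * ip A M p (Omega_star A M Y (fJ A M Z) p) (X p)))"
    (is "_ \<longleftrightarrow> (\<forall>Y\<in>_. \<forall>Z\<in>_. \<forall>X\<in>_. \<forall>N\<in>_. (\<forall>p. ?I Y Z p (N p)) \<and> (\<forall>p. ?II Y Z p (X p)))")
proof -
  note lb = assms(1) and sg = assms(3)
  note ll = screen_generic_lightlike[OF lb sg]
  have I: "?I Y Z p n \<longleftrightarrow> ip A M p (Omega A M Y Z p) n = 0"
    if "Y \<in> sections A M (B' A M)" "Z \<in> sections A M (B' A M)" "n \<in> ltr M p" for Y Z p n
  proof -
    have Jn: "J A M p n \<in> ltr M p" using ltr_invariant that(3) by blast
    have "Y p \<in> scr M p" using that(1) by (simp add: sections_def B'_def)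
    then have "ip A M p (Y p) n = 0" "ip A M p (Y p) (J A M p n) = 0"
      using ltr_perp_scr[OF lb ll] that(3) Jn by (simp_all add: ip_commute[OF lb ll, of p "Y p"])
    then show ?thesis
      using ip_Omega_bronze[OF lb sg that(1,2), of n p] that(3) Jn
      by (auto simp: ip_h_star[OF lb ll])
  qed
  have II: "?II Y Z p x \<longleftrightarrow> ip A M p (Omega A M Y Z p) x = 0"
    if "Y \<in> sections A M (B' A M)" "Z \<in> sections A M (B' A M)" "x \<in> Bo A M p" for Y Z p x
  proof -
    have Jx: "J A M p x \<in> Bo A M p" by (rule J_Bo[OF lb sg that(3)])
    have scr: "x \<in> scr M p" "J A M p x \<in> scr M p" using Jx that(3) by (auto simp: Bo_def)
    have "ip A M p (Y p) x = 0" "ip A M p (Y p) (J A M p x) = 0"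
      using that Jx by (auto simp: sections_def B'_def)
    then show ?thesis
      using ip_Omega_bronze[OF lb sg that(1,2), of x p] scr
      by (auto simp: ip_Omega_star[OF lb ll])
  qed
  obtain k k' where bundles: "subbundle A M k (Bo A M)" "subbundle A M k' (ltr M)"
  proof -
    have "\<exists>k. subbundle A M k (Bo A M)" using sg unfolding screen_generic_def by (elim conjE)
    moreover have "\<exists>k. subbundle A M k (ltr M)"
      using ll unfolding lightlike_submanifold_def by blast
    ultimately show ?thesis using that by blast
  qed
  note through = section_through[OF atl_manifold[OF lb ll] satl_manifold[OF lb ll] imm_continuous[OF lb ll]]
  show ?thesis
  proof
    assume "B'_parallel A M"
    then show "\<forall>Y\<in>sections A M (B' A M). \<forall>Z\<in>sections A M (B' A M).
        \<forall>X\<in>sections A M (Bo A M). \<forall>N\<in>sections A M (ltr M). (\<forall>p. ?I Y Z p (N p)) \<and> (\<forall>p. ?II Y Z p (X p))"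
      unfolding B'_parallel_def Omega_in_B'_iff[OF lb sg]
      by (simp add: I II sections_def)
  next
    assume R: "\<forall>Y\<in>sections A M (B' A M). \<forall>Z\<in>sections A M (B' A M).
        \<forall>X\<in>sections A M (Bo A M). \<forall>N\<in>sections A M (ltr M). (\<forall>p. ?I Y Z p (N p)) \<and> (\<forall>p. ?II Y Z p (X p))"
    show "B'_parallel A M"
      unfolding B'_parallel_def Omega_in_B'_iff[OF lb sg]
    proof (intro ballI allI conjI)
      fix Y Z p n x
      assume YZ: "Y \<in> sections A M (B' A M)" "Z \<in> sections A M (B' A M)"
      \<comment> \<open>The conditions are quantified jointly over sections of \<open>Bo\<close> and
        \<open>ltr\<close>. Testing one of them requires some section of the other bundle, obtained
        by extending the zero vector.\<close>
      have zero: "0 \<in> Bo A M p" "0 \<in> ltr M p"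
        using bundles[THEN subbundle_subspace] subspace_0 by blast+
      show "ip A M p (Omega A M Y Z p) n = 0" if n: "n \<in> ltr M p"
      proof -
        obtain N where N: "N \<in> sections A M (ltr M)" "N p = n" using through[OF bundles(2) n] by blast
        obtain X where X: "X \<in> sections A M (Bo A M)" using through[OF bundles(1) zero(1)] by blast
        have "?I Y Z p (N p)" using R YZ N(1) X by blast
        then show ?thesis using I[OF YZ n] by (simp only: N(2))
      qed
      show "ip A M p (Omega A M Y Z p) x = 0" if x: "x \<in> Bo A M p"
      proof -
        obtain X where X: "X \<in> sections A M (Bo A M)" "X p = x" using through[OF bundles(1) x] by blast
        obtain N where N: "N \<in> sections A M (ltr M)" using through[OF bundles(2) zero(2)] by blast
        have "?II Y Z p (X p)" using R YZ X(1) N by blast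
        then show ?thesis using II[OF YZ x] by (simp only: X(2))
      qed
    qed
  qed
qed

end
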